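(* The separation problem over the linking polyhedron in the case of identical coefficients can be solved in polynomial time. That is, for a finite nonempty index set $M$ with $n=|M|$ and $$V=\operatorname{conv}\Bigl\{(x,y)\in\{0,1\}^{M}\times\{0,1\}^{n}:\ \sum_{j\in M}x_j=\sum_{k=1}^{n}k\,y_k,\ \ \sum_{k=1}^{n}y_k\le1\Bigr\},$$ there is an algorithm which, given $M$ and a rational point $(x^*,y^* )\in\mathbb Q^{M}\times\mathbb Q^{n}$, runs in time polynomial in the input size and either correctly asserts that $(x^*,y^* )\in V$ or returns a linear inequality that is valid for $V$ and violated by $(x^*,y^* )$.
   Context: The separation problem over a polyhedron $V$ is: given a rational point, decide whether it belongs to $V$ and, if not, return a linear inequality valid for $V$ but violated by the point. The input size is measured by $|M|$ together with the binary encoding length of the rational point. *)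

theory Defs
  imports
    "HOL-Analysis.Analysis"
    "HOL-Analysis.Finite_Function_Topology"
    "HOL-Library.Log_Nat"
    "HOL-Computational_Algebra.Polynomial"
begin

section \<open>Random access machine with logarithmic cost\<close>

text \<open>
  Polynomial time is measured on a random access machine with logarithmic cost, programmed in a
  structured language. The memory has banks 0, 1, 2, ..., each of them an array of integers indexed
  by integers; a program mentions only finitely many banks, since bank numbers are literals, while
  cell addresses are computed. Every evaluation step is charged the binary length of the integer it
  produces. Addresses and stored values are results of charged evaluation steps, and the only
  arithmetic operations are addition, subtraction and multiplication, so a run of cost t can be
  simulated by a multi-tape Turing machine in time polynomial in t and the length of the input,
  and conversely.
\<close>

type_synonym store = "nat \<Rightarrow> int \<Rightarrow> int"

datatype aexp =
    Const int
  | Cell nat aexp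
  | Add aexp aexp
  | Sub aexp aexp
  | Mul aexp aexp

datatype com =
    Skip
  | Store nat aexp aexp
  | Seq com com
  | Cond aexp com com
  | Loop aexp com

text \<open>Sign and binary digits of the absolute value.\<close>

definition int_size :: "int \<Rightarrow> nat" where
  "int_size z = 1 + nat (bitlen \<bar>z\<bar>)"

fun aval :: "aexp \<Rightarrow> store \<Rightarrow> int" where
  "aval (Const c) s = c"
| "aval (Cell b a) s = s b (aval a s)"
| "aval (Add a1 a2) s = aval a1 s + aval a2 s"
| "aval (Sub a1 a2) s = aval a1 s - aval a2 s"
| "aval (Mul a1 a2) s = aval a1 s * aval a2 s"

fun acost :: "aexp \<Rightarrow> store \<Rightarrow> nat" where
  "acost (Const c) s = int_size c"
| "acost (Cell b a) s = acost a s + int_size (s b (aval a s))"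
| "acost (Add a1 a2) s = acost a1 s + acost a2 s + int_size (aval a1 s + aval a2 s)"
| "acost (Sub a1 a2) s = acost a1 s + acost a2 s + int_size (aval a1 s - aval a2 s)"
| "acost (Mul a1 a2) s = acost a1 s + acost a2 s + int_size (aval a1 s * aval a2 s)"

text \<open>
  \<open>exec c s t s'\<close>: started in store \<open>s\<close>, the program \<open>c\<close> halts in store \<open>s'\<close>, at cost \<open>t\<close>.
  The tests of \<open>Cond\<close> and \<open>Loop\<close> succeed if their expression is positive.
\<close>

inductive exec :: "com \<Rightarrow> store \<Rightarrow> nat \<Rightarrow> store \<Rightarrow> bool" where
  Skip: "exec Skip s 1 s"
| Store: "exec (Store b a e) s (1 + acost a s + acost e s)
    (s(b := (s b)(aval a s := aval e s)))"
| Seq: "exec c1 s t1 s1 \<Longrightarrow> exec c2 s1 t2 s2 \<Longrightarrow> exec (Seq c1 c2) s (t1 + t2) s2"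
| CondTrue: "0 < aval e s \<Longrightarrow> exec c1 s t s1 \<Longrightarrow> exec (Cond e c1 c2) s (1 + acost e s + t) s1"
| CondFalse: "\<not> 0 < aval e s \<Longrightarrow> exec c2 s t s1 \<Longrightarrow> exec (Cond e c1 c2) s (1 + acost e s + t) s1"
| LoopTrue: "0 < aval e s \<Longrightarrow> exec c s t1 s1 \<Longrightarrow> exec (Loop e c) s1 t2 s2 \<Longrightarrow>
    exec (Loop e c) s (1 + acost e s + t1 + t2) s2"
| LoopFalse: "\<not> 0 < aval e s \<Longrightarrow> exec (Loop e c) s (1 + acost e s) s"

section \<open>The linking polyhedron\<close>

text \<open>
  A vector indexed by a finite set \<open>I\<close> of natural numbers is a finitely supported function whose
  support is contained in \<open>I\<close>, so that all dimensions live in a single real vector space. Index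
  sets \<open>M\<close> of natural numbers cover all finite sets up to renaming of the elements.
\<close>

type_synonym 'k point = "(nat \<Rightarrow>\<^sub>0 'k) \<times> (nat \<Rightarrow>\<^sub>0 'k)"

definition linking_points :: "nat set \<Rightarrow> real point set" where
  "linking_points M = {(x, y).
     Poly_Mapping.keys x \<subseteq> M \<and> Poly_Mapping.keys y \<subseteq> {1..card M} \<and>
     (\<forall>j\<in>M. Poly_Mapping.lookup x j \<in> {0, 1}) \<and>
     (\<forall>k\<in>{1..card M}. Poly_Mapping.lookup y k \<in> {0, 1}) \<and>
     (\<Sum>j\<in>M. Poly_Mapping.lookup x j) = (\<Sum>k=1..card M. real k * Poly_Mapping.lookup y k) \<and>
     (\<Sum>k=1..card M. Poly_Mapping.lookup y k) \<le> 1}"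

definition linking_polyhedron :: "nat set \<Rightarrow> real point set" where
  "linking_polyhedron M = convex hull (linking_points M)"

definition real_point :: "rat point \<Rightarrow> real point" where
  "real_point z = (Poly_Mapping.map of_rat (fst z), Poly_Mapping.map of_rat (snd z))"

section \<open>Input and output of a separation algorithm\<close>

text \<open>
  The index set is presented by a list \<open>ms\<close> enumerating it without repetition. Its elements are mere
  names: only their number is passed to the program, and coordinates are identified by their
  position in \<open>ms\<close>. Rational numbers are passed as numerator and denominator in lowest terms.
\<close>

definition rat_code :: "rat \<Rightarrow> int list" where
  "rat_code r = [fst (quotient_of r), snd (quotient_of r)]"

definition rat_size :: "rat \<Rightarrow> nat" where
  "rat_size r = int_size (fst (quotient_of r)) + int_size (snd (quotient_of r))"

definition input_code :: "nat list \<Rightarrow> rat point \<Rightarrow> int list" where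
  "input_code ms z =
     int (length ms) #
     concat (map (\<lambda>j. rat_code (Poly_Mapping.lookup (fst z) j)) ms) @
     concat (map (\<lambda>k. rat_code (Poly_Mapping.lookup (snd z) k)) [1..<Suc (length ms)])"

definition input_size :: "nat list \<Rightarrow> rat point \<Rightarrow> nat" where
  "input_size ms z =
     length ms + (\<Sum>j\<in>set ms. rat_size (Poly_Mapping.lookup (fst z) j))
               + (\<Sum>k=1..length ms. rat_size (Poly_Mapping.lookup (snd z) k))"

definition input_store :: "nat list \<Rightarrow> rat point \<Rightarrow> store" where
  "input_store ms z = (\<lambda>b i.
     if b = 0 \<and> 0 \<le> i \<and> i < int (length (input_code ms z)) then input_code ms z ! nat i else 0)"

text \<open>
  The output is read off bank 1. Cell 0 contains the verdict: 1 asserts membership, 0 announces a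
  linear inequality \<open>(\<Sum>j\<in>M. \<alpha> j * x j) + (\<Sum>k=1..n. \<beta> k * y k) \<le> \<gamma>\<close> with integer coefficients, whose
  \<open>\<alpha> (ms ! i)\<close>, \<open>\<beta> k\<close> and \<open>\<gamma>\<close> are in the cells \<open>i + 1\<close>, \<open>n + k\<close> and \<open>2 * n + 1\<close>, respectively.
\<close>

definition asserts_membership :: "store \<Rightarrow> bool" where
  "asserts_membership s \<longleftrightarrow> s 1 0 = 1"

definition returns_inequality :: "store \<Rightarrow> bool" where
  "returns_inequality s \<longleftrightarrow> s 1 0 = 0"

definition satisfies_output :: "nat list \<Rightarrow> store \<Rightarrow> real point \<Rightarrow> bool" where
  "satisfies_output ms s z \<longleftrightarrow>
     (\<Sum>i<length ms. of_int (s 1 (int i + 1)) * Poly_Mapping.lookup (fst z) (ms ! i))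
     + (\<Sum>k=1..length ms. of_int (s 1 (int (length ms + k))) * Poly_Mapping.lookup (snd z) k)
     \<le> of_int (s 1 (2 * int (length ms) + 1))"

definition correct_answer :: "real point set \<Rightarrow> nat list \<Rightarrow> real point \<Rightarrow> store \<Rightarrow> bool" where
  "correct_answer V ms z s \<longleftrightarrow>
     asserts_membership s \<and> z \<in> V \<or>
     returns_inequality s \<and> (\<forall>v\<in>V. satisfies_output ms s v) \<and> \<not> satisfies_output ms s z"

end

theory Submission
  imports Defs
begin

text \<open>
  Besides \<open>(0, 0)\<close>, the points of which \<open>V\<close> is the convex hull are the pairs \<open>(x, e_k)\<close>, where \<open>x\<close> is a
  vertex of the hypersimplex \<open>H_k\<close> of 0/1-vectors of sum \<open>k\<close>. So \<open>(x, y) \<in> V\<close> means that \<open>y \<ge> 0\<close>,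
  \<open>\<Sum>y \<le> 1\<close> and that \<open>x\<close> lies in the Minkowski sum of the \<open>y_k H_k\<close>. Each \<open>H_k\<close> is the base polytope of
  a uniform matroid, so this sum is the base polytope of \<open>f(S) = \<Sum>k. min |S| k * y_k\<close>, given by
  \<open>x(S) \<le> f(S)\<close> for all \<open>S \<subseteq> M\<close> together with \<open>x(M) = f(M) = \<Sum>k. k * y_k\<close>.

  Since \<open>f\<close> depends on \<open>|S|\<close> only, among the sets of a given size it suffices to look at one with the
  largest coordinates of \<open>x\<close>. With ties broken by position this leaves \<open>n\<close> sets, the upper level sets
  of \<open>x\<close>, one for each element of \<open>M\<close>. Hence \<open>V\<close> contains a given point as soon as the point
  satisfies \<open>2 n + 2\<close> inequalities: the \<open>n\<close> level set inequalities (which for \<open>S = M\<close> give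
  \<open>x(M) \<le> \<Sum>k. k * y_k\<close>), the \<open>n\<close> inequalities \<open>y_k \<ge> 0\<close>, then \<open>\<Sum>y \<le> 1\<close>, and \<open>\<Sum>k. k * y_k \<le> x(M)\<close>.

  That these inequalities suffice (\<open>in_linking_polyhedronI\<close>) is a form of the theorem of Rado on
  majorization. If \<open>\<sigma>\<close> enumerates \<open>M\<close> by decreasing \<open>x\<close>, the point \<open>z\<close> of the base polytope with
  \<open>z(\<sigma> i) = \<Sum>k>i. y_k\<close> attains equality on all initial segments, and \<open>(z, y) \<in> V\<close> is an explicit convex
  combination. The inequalities say that \<open>x\<close> is majorized by \<open>z\<close>, so that \<open>x\<close> is reached from \<open>z\<close> by
  finitely many transfers from a larger to a smaller coordinate, and \<open>V\<close>, being convex and invariant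
  under permutations of \<open>M\<close>, is closed under transfers.

  The program writes down the \<open>2 n + 2\<close> inequalities in turn, evaluates each at the given point, and
  stops at the first violated one. No sorting is needed, since a level set is found by comparing every
  coordinate with a fixed one. A rational number is added to a fraction \<open>p / q\<close> without cancellation,
  so \<open>q\<close> is a product of denominators of the input and \<open>p\<close> is of comparable size; all numbers that
  occur have linear length. The number of steps is quadratic in \<open>n\<close>, so the time is polynomial.
\<close>

section \<open>Points of the linking polyhedron\<close>

abbreviation coord :: "(nat \<Rightarrow>\<^sub>0 'k::zero) \<Rightarrow> nat \<Rightarrow> 'k" where
  "coord \<equiv> Poly_Mapping.lookup"

lemma coord_scaleR: "coord (r *\<^sub>R u) j = r * coord u j"
  by (simp add: scaleR_poly_mapping_def Poly_Mapping.map.rep_eq when_def)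

lemmas coord_simps = lookup_add lookup_minus coord_scaleR lookup_single when_def

abbreviation unit :: "nat \<Rightarrow> nat \<Rightarrow>\<^sub>0 real" where
  "unit j \<equiv> Poly_Mapping.single j 1"

text \<open>
  Exchanging two coordinates is written as a linear expression in \<open>u\<close>, so that it commutes with convex
  hulls and its multiples interpolate between \<open>u\<close> and the exchanged vector.
\<close>
definition swap_coords :: "nat \<Rightarrow> nat \<Rightarrow> (nat \<Rightarrow>\<^sub>0 real) \<Rightarrow> (nat \<Rightarrow>\<^sub>0 real)" where
  "swap_coords a b u = u + (coord u a - coord u b) *\<^sub>R (unit b - unit a)"

lemma coord_swap_coords:
  "coord (swap_coords a b u) j = (if j = a then coord u b else if j = b then coord u a else coord u j)"
  by (auto simp: swap_coords_def coord_simps)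

lemma linking_points_swap:
  assumes "(u, y) \<in> linking_points M" "finite M" "a \<in> M" "b \<in> M"
  shows "(swap_coords a b u, y) \<in> linking_points M"
proof -
  have "(\<Sum>j\<in>M. coord (swap_coords a b u) j) = (\<Sum>j\<in>M. coord u j)"
    using assms(2-4)
    by (simp add: swap_coords_def coord_simps sum.distrib flip: sum_distrib_left)
      (simp add: sum_subtractf)
  moreover have "Poly_Mapping.keys (swap_coords a b u) \<subseteq> M"
    using assms by (auto simp: linking_points_def coord_swap_coords in_keys_iff subset_iff split: if_splits)
  ultimately show ?thesis
    using assms by (auto simp: linking_points_def coord_swap_coords)
qed

lemma linear_swap: "linear (\<lambda>(u, y). (swap_coords a b u, y :: nat \<Rightarrow>\<^sub>0 real))"
  by (rule linearI) (auto simp: swap_coords_def coord_simps algebra_simps intro!: poly_mapping_eqI)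

lemma linking_polyhedron_swap:
  assumes "(u, y) \<in> linking_polyhedron M" "finite M" "a \<in> M" "b \<in> M"
  shows "(swap_coords a b u, y) \<in> linking_polyhedron M"
proof -
  let ?T = "\<lambda>(u, y). (swap_coords a b u, y :: nat \<Rightarrow>\<^sub>0 real)"
  have "?T (u, y) \<in> ?T ` (convex hull linking_points M)"
    using assms(1) unfolding linking_polyhedron_def by (rule imageI)
  also have "\<dots> = convex hull (?T ` linking_points M)"
    by (rule convex_hull_linear_image[OF linear_swap])
  also have "\<dots> \<subseteq> convex hull (linking_points M)"
    using linking_points_swap[OF _ assms(2-4)] by (intro hull_mono) auto
  finally show ?thesis by (simp add: linking_polyhedron_def)
qed

text \<open>
  The result of a partial transfer is a convex combination of \<open>u\<close> and \<open>u\<close> with two coordinates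
  swapped.
\<close>
lemma linking_polyhedron_transfer:
  assumes V: "(u, y) \<in> linking_polyhedron M" and M: "finite M" "a \<in> M" "b \<in> M"
    and d: "0 \<le> d" "d \<le> coord u a - coord u b"
  shows "(u + d *\<^sub>R (unit b - unit a), y) \<in> linking_polyhedron M"
proof (cases "d = 0")
  case True
  then show ?thesis using V by simp
next
  case False
  define D where "D = coord u a - coord u b"
  have D: "D > 0" "d \<le> D" using False d unfolding D_def by linarith+
  have "(1 - d / D) *\<^sub>R (u, y) + (d / D) *\<^sub>R (swap_coords a b u, y) \<in> linking_polyhedron M"
    using D d(1) linking_polyhedron_swap[OF V M] V convex_convex_hull
    unfolding linking_polyhedron_def by (intro convexD) auto
  also have "(1 - d / D) *\<^sub>R (u, y) + (d / D) *\<^sub>R (swap_coords a b u, y) = (u + d *\<^sub>R (unit b - unit a), y)"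
    using D by (simp add: swap_coords_def D_def[symmetric] scaleR_add_right scaleR_left_diff_distrib)
  finally show ?thesis .
qed

text \<open>
  The induction is on the number of positions in which \<open>x\<close> and \<open>z\<close> differ; a transfer of the
  largest admissible amount between two neighbouring defects of opposite sign repairs one of them.
  A transfer may leave \<open>z\<close> unsorted; it still moves from a larger to a smaller coordinate, because
  \<open>z\<close> exceeds \<open>x\<close> at the first position, falls below \<open>x\<close> at the second, and \<open>x\<close> decreases.
\<close>
lemma linking_polyhedron_majorization:
  fixes x z :: "nat \<Rightarrow>\<^sub>0 real" and n :: nat
  assumes M: "finite M" and \<sigma>: "bij_betw \<sigma> {..<n} M"
    and x: "Poly_Mapping.keys x \<subseteq> M" and z: "Poly_Mapping.keys z \<subseteq> M"
    and V: "(z, y) \<in> linking_polyhedron M"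
    and anti: "\<And>i j. i < j \<Longrightarrow> j < n \<Longrightarrow> coord x (\<sigma> j) \<le> coord x (\<sigma> i)"
    and le: "\<And>s. s \<le> n \<Longrightarrow> (\<Sum>i<s. coord x (\<sigma> i)) \<le> (\<Sum>i<s. coord z (\<sigma> i))"
    and eq: "(\<Sum>i<n. coord x (\<sigma> i)) = (\<Sum>i<n. coord z (\<sigma> i))"
  shows "(x, y) \<in> linking_polyhedron M"
  using z V le eq
proof (induction "card {i. i < n \<and> coord x (\<sigma> i) \<noteq> coord z (\<sigma> i)}" arbitrary: z rule: less_induct)
  case less
  note le = less.prems(3) and eq = less.prems(4)
  let ?bad = "\<lambda>z. {i. i < n \<and> coord x (\<sigma> i) \<noteq> coord z (\<sigma> i)}"
  have inj: "inj_on \<sigma> {..<n}" and img: "\<sigma> ` {..<n} = M"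
    using \<sigma> by (auto simp: bij_betw_def)
  show ?case
  proof (cases "\<exists>b<n. coord x (\<sigma> b) > coord z (\<sigma> b)")
    case False
    have "coord x (\<sigma> i) = coord z (\<sigma> i)" if "i < n" for i
    proof (rule ccontr)
      assume "coord x (\<sigma> i) \<noteq> coord z (\<sigma> i)"
      moreover have x_le_z: "\<forall>b<n. coord x (\<sigma> b) \<le> coord z (\<sigma> b)"
        using False by (meson not_less)
      ultimately have "coord x (\<sigma> i) < coord z (\<sigma> i)" using that by (simp add: less_le)
      then have "(\<Sum>i<n. coord x (\<sigma> i)) < (\<Sum>i<n. coord z (\<sigma> i))"
        using x_le_z that by (intro sum_strict_mono_ex1) auto
      then show False using eq by simp
    qed
    then have on_M: "coord x (\<sigma> i) = coord z (\<sigma> i)" if "i < n" for i using that by blast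
    have "coord x j = coord z j" for j
    proof (cases "j \<in> M")
      case False
      then have "coord x j = 0" "coord z j = 0" using x less.prems(1) by (auto simp: in_keys_iff)
      then show ?thesis by simp
    qed (use img on_M in auto)
    then have "x = z" by (intro poly_mapping_eqI) simp
    then show ?thesis using less.prems(2) by simp
  next
    case True
    \<comment> \<open>\<open>b\<close> is the first position where \<open>z\<close> has too little, \<open>a\<close> below the last one before \<open>b\<close> where it has too much.\<close>
    define b where "b = (LEAST b. b < n \<and> coord x (\<sigma> b) > coord z (\<sigma> b))"
    have b: "b < n" "coord x (\<sigma> b) > coord z (\<sigma> b)"
      using LeastI_ex[OF True[unfolded Bex_def]] unfolding b_def by auto
    have below_b: "coord x (\<sigma> i) \<le> coord z (\<sigma> i)" if "i < b" for i
      using not_less_Least[OF that[unfolded b_def]] that b(1) by auto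
    have "\<exists>a<b. coord x (\<sigma> a) < coord z (\<sigma> a)"
    proof (rule ccontr)
      assume "\<not> ?thesis"
      then have "(\<Sum>i<b. coord z (\<sigma> i)) \<le> (\<Sum>i<b. coord x (\<sigma> i))"
        by (intro sum_mono) (meson lessThan_iff not_less)
      then have "(\<Sum>i<Suc b. coord z (\<sigma> i)) < (\<Sum>i<Suc b. coord x (\<sigma> i))" using b(2) by simp
      then show False using le[of "Suc b"] b(1) by simp
    qed
    then obtain a0 where a0: "a0 < b \<and> coord x (\<sigma> a0) < coord z (\<sigma> a0)" by blast
    define a where "a = (GREATEST a. a < b \<and> coord x (\<sigma> a) < coord z (\<sigma> a))"
    have a: "a < b" "coord x (\<sigma> a) < coord z (\<sigma> a)"
      using GreatestI_nat[of "\<lambda>a. a < b \<and> coord x (\<sigma> a) < coord z (\<sigma> a)", OF a0, of b]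
      unfolding a_def by auto
    have between: "coord x (\<sigma> i) = coord z (\<sigma> i)" if "a < i" "i < b" for i
    proof (rule ccontr)
      assume "coord x (\<sigma> i) \<noteq> coord z (\<sigma> i)"
      then have "i \<le> a" unfolding a_def
        using that below_b[OF that(2)] by (intro Greatest_le_nat[of _ _ b]) auto
      then show False using that by simp
    qed
    define d where "d = min (coord z (\<sigma> a) - coord x (\<sigma> a)) (coord x (\<sigma> b) - coord z (\<sigma> b))"
    have d: "0 < d" "d \<le> coord z (\<sigma> a) - coord x (\<sigma> a)" "d \<le> coord x (\<sigma> b) - coord z (\<sigma> b)"
      using a b by (auto simp: d_def)
    define z' where "z' = z + d *\<^sub>R (unit (\<sigma> b) - unit (\<sigma> a))"
    have mem: "\<sigma> a \<in> M" "\<sigma> b \<in> M" using a b img by auto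
    have "\<sigma> a \<noteq> \<sigma> b" using inj a b by (auto dest: inj_onD)
    have z': "coord z' (\<sigma> i) = coord z (\<sigma> i) + (if i = b then d else 0) - (if i = a then d else 0)" if "i < n" for i
      using that inj a b by (auto simp: z'_def coord_simps dest: inj_onD)
    have V': "(z', y) \<in> linking_polyhedron M"
      unfolding z'_def using mem M less.prems(2) d anti[OF a(1) b(1)]
      by (intro linking_polyhedron_transfer) auto
    have keys': "Poly_Mapping.keys z' \<subseteq> M"
      using less.prems(1) mem by (auto simp: z'_def coord_simps in_keys_iff subset_iff split: if_splits)
    have sum': "(\<Sum>i<s. coord z' (\<sigma> i)) = (\<Sum>i<s. coord z (\<sigma> i)) + (if b < s then d else 0) - (if a < s then d else 0)"
      if "s \<le> n" for s
    proof -
      have "(\<Sum>i<s. coord z' (\<sigma> i)) =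
          (\<Sum>i<s. coord z (\<sigma> i) + (if i = b then d else 0) - (if i = a then d else 0))"
        using that by (intro sum.cong) (auto simp: z')
      then show ?thesis by (simp add: sum.distrib sum_subtractf)
    qed
    \<comment> \<open>Only the prefixes that contain \<open>a\<close> but not \<open>b\<close> lose the amount \<open>d\<close>; the excess at \<open>a\<close> pays for it.\<close>
    have le': "(\<Sum>i<s. coord x (\<sigma> i)) \<le> (\<Sum>i<s. coord z' (\<sigma> i))" if s: "s \<le> n" for s
    proof (cases "a < s \<and> s \<le> b")
      case True
      have "d \<le> coord z (\<sigma> a) - coord x (\<sigma> a)" by (rule d)
      also have "\<dots> = (\<Sum>i\<in>{a}. coord z (\<sigma> i) - coord x (\<sigma> i))" by simp
      also have "\<dots> \<le> (\<Sum>i<s. coord z (\<sigma> i) - coord x (\<sigma> i))"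
        using True below_b by (intro sum_mono2) auto
      finally show ?thesis using True sum'[OF s] by (simp add: sum_subtractf)
    next
      case False
      then show ?thesis using sum'[OF s] le[OF s] a(1) by auto
    qed
    have "?bad z' \<subset> ?bad z"
    proof -
      have "?bad z' \<subseteq> ?bad z" using a b z' by (auto split: if_splits)
      moreover have "a \<in> ?bad z" "b \<in> ?bad z" using a b by auto
      moreover have "a \<notin> ?bad z' \<or> b \<notin> ?bad z'"
        using a b z'[of a] z'[of b] unfolding d_def min_def by (auto split: if_splits)
      ultimately show ?thesis by blast
    qed
    then have "card (?bad z') < card (?bad z)" by (intro psubset_card_mono) auto
    then show ?thesis
      using less.hyps[of z'] keys' V' le' eq sum'[of n] a b by auto
  qed
qed

text \<open>
  The first component takes the value \<open>\<Sum>k>i. y_k\<close> at \<open>\<sigma> i\<close>; it is the greedy point of the base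
  polytope for the order \<open>\<sigma>\<close>.
\<close>
lemma staircase_in_linking_polyhedron:
  fixes y :: "nat \<Rightarrow>\<^sub>0 real"
  assumes M: "finite M" "card M = n" and \<sigma>: "bij_betw \<sigma> {..<n} M"
    and y: "Poly_Mapping.keys y \<subseteq> {1..n}" "\<And>k. k \<in> {1..n} \<Longrightarrow> 0 \<le> coord y k" "(\<Sum>k=1..n. coord y k) \<le> 1"
  shows "((\<Sum>k=1..n. coord y k *\<^sub>R (\<Sum>i<k. unit (\<sigma> i))), y) \<in> linking_polyhedron M"
proof -
  have inj: "inj_on \<sigma> {..<n}" and img: "\<sigma> ` {..<n} = M"
    using \<sigma> by (auto simp: bij_betw_def)
  \<comment> \<open>The weight that \<open>y\<close> leaves over goes to the origin, treated as the point for \<open>k = 0\<close>.\<close>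
  define P where "P k = ((\<Sum>i<k. unit (\<sigma> i)), if k = 0 then 0 else unit k)" for k
  define w where "w k = (if k = 0 then 1 - (\<Sum>k=1..n. coord y k) else coord y k)" for k
  have P: "P k \<in> linking_points M" if k: "k \<le> n" for k
  proof -
    define u where "u = (\<Sum>i<k. unit (\<sigma> i))"
    have u: "coord u j = (if j \<in> \<sigma> ` {..<k} then 1 else 0)" for j
    proof -
      have "coord u j = (\<Sum>i<k. if \<sigma> i = j then 1 else 0)"
        by (simp add: u_def lookup_sum lookup_single when_def)
      also have "\<dots> = (\<Sum>l\<in>\<sigma> ` {..<k}. if l = j then 1 else 0)"
        using inj k by (subst sum.reindex) (auto intro: inj_on_subset)
      finally show ?thesis by simp
    qed
    have sub: "\<sigma> ` {..<k} \<subseteq> M" using img k by auto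
    have "(\<Sum>j\<in>M. coord u j) = real (card (\<sigma> ` {..<k}))"
      using sub M by (simp add: u sum.If_cases Int_absorb1 Int_commute)
    also have "card (\<sigma> ` {..<k}) = k"
      using inj k by (subst card_image) (auto intro: inj_on_subset)
    finally have s: "(\<Sum>j\<in>M. coord u j) = real k" .
    have keys: "Poly_Mapping.keys u \<subseteq> M" using sub by (auto simp: in_keys_iff u split: if_splits)
    have "(\<Sum>l=1..n. real l * (if k = l then 1 else 0)) = (\<Sum>l=1..n. if k = l then real l else 0)"
      by (intro sum.cong) auto
    then have "(\<Sum>l=1..n. real l * coord (snd (P k)) l) = real k"
      using k by (simp add: P_def lookup_single when_def)
    then show ?thesis
      using k keys M s unfolding linking_points_def
      by (auto simp: P_def u lookup_single when_def simp flip: u_def)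
  qed
  have "(\<Sum>k\<in>{0..n}. w k *\<^sub>R P k) \<in> linking_polyhedron M"
    unfolding linking_polyhedron_def
  proof (intro convex_sum convex_convex_hull)
    show "sum w {0..n} = 1" by (simp add: sum.atLeast_Suc_atMost w_def)
    show "0 \<le> w i" if "i \<in> {0..n}" for i using y(2)[of i] y(3) that by (auto simp: w_def)
    show "P i \<in> convex hull linking_points M" if "i \<in> {0..n}" for i
      using P[of i] that by (intro hull_inc) auto
  qed auto
  also have "(\<Sum>k\<in>{0..n}. w k *\<^sub>R P k) = (\<Sum>k=1..n. coord y k *\<^sub>R P k)"
    by (simp add: sum.atLeast_Suc_atMost w_def P_def flip: zero_prod_def)
  also have "\<dots> = ((\<Sum>k=1..n. coord y k *\<^sub>R (\<Sum>i<k. unit (\<sigma> i))), (\<Sum>k=1..n. coord y k *\<^sub>R unit k))"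
    by (rule prod_eqI) (auto simp: fst_sum snd_sum P_def intro!: sum.cong)
  also have "(\<Sum>k=1..n. coord y k *\<^sub>R unit k) = y"
  proof (rule poly_mapping_eqI)
    fix j
    have "coord (\<Sum>k=1..n. coord y k *\<^sub>R unit k) j = (\<Sum>k=1..n. if k = j then coord y k else 0)"
      unfolding lookup_sum by (intro sum.cong) (auto simp: coord_simps)
    also have "\<dots> = coord y j"
    proof (cases "j \<in> {1..n}")
      case False
      then have "coord y j = 0" using y(1) by (auto simp: in_keys_iff)
      then show ?thesis using False by simp
    qed simp
    finally show "coord (\<Sum>k=1..n. coord y k *\<^sub>R unit k) j = coord y j" .
  qed
  finally show ?thesis .
qed

lemma ex_decreasing_enumeration:
  fixes \<kappa> :: "'a \<Rightarrow> int"
  assumes "finite M" "inj_on \<kappa> M"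
  obtains \<sigma> where "bij_betw \<sigma> {..<card M} M"
    "\<And>i j. i < j \<Longrightarrow> j < card M \<Longrightarrow> \<kappa> (\<sigma> j) < \<kappa> (\<sigma> i)"
proof -
  let ?f = "\<lambda>j. - \<kappa> j"
  define xs where "xs = sorted_list_of_set (?f ` M)"
  have inj: "inj_on ?f M" using assms(2) by (auto simp: inj_on_def)
  have len: "length xs = card M" using inj by (simp add: xs_def card_image)
  have set: "set xs = ?f ` M" and dist: "distinct xs" using assms(1) by (auto simp: xs_def)
  define \<sigma> where "\<sigma> i = inv_into M ?f (xs ! i)" for i
  have "bij_betw ((!) xs) {..<card M} (?f ` M)" by (rule bij_betw_nth) (auto simp: len set dist)
  moreover have "bij_betw (inv_into M ?f) (?f ` M) M"
    using inj by (intro bij_betw_inv_into) (simp add: bij_betw_def)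
  ultimately have bij: "bij_betw (inv_into M ?f \<circ> (!) xs) {..<card M} M" by (rule bij_betw_trans)
  have \<kappa>: "\<kappa> (\<sigma> i) = - xs ! i" if "i < card M" for i
    using f_inv_into_f[of "xs ! i" ?f M] that len set nth_mem[of i xs] unfolding \<sigma>_def by fastforce
  have "xs ! i < xs ! j" if "i < j" "j < card M" for i j
    using that len sorted_wrt_nth_less[of "(<)" xs i j] by (simp add: xs_def)
  then show ?thesis using \<kappa> bij by (intro that[of \<sigma>]) (auto simp: \<sigma>_def[abs_def] comp_def)
qed

text \<open>
  The injective integer key \<open>\<kappa>\<close> refines the order of the coordinates of \<open>x\<close> by breaking ties. Thereby
  the level sets of \<open>\<kappa>\<close> are exactly the nonempty initial segments of a decreasing enumeration, and
  the inequalities for them compare all prefix sums of \<open>x\<close> with those of the staircase.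
\<close>
lemma in_linking_polyhedronI:
  fixes x y :: "nat \<Rightarrow>\<^sub>0 real" and \<kappa> :: "nat \<Rightarrow> int"
  assumes M: "finite M" "card M = n" and x: "Poly_Mapping.keys x \<subseteq> M"
    and y: "Poly_Mapping.keys y \<subseteq> {1..n}" "\<And>k. k \<in> {1..n} \<Longrightarrow> 0 \<le> coord y k" "(\<Sum>k=1..n. coord y k) \<le> 1"
    and total: "(\<Sum>j\<in>M. coord x j) = (\<Sum>k=1..n. real k * coord y k)"
    and \<kappa>: "inj_on \<kappa> M" "\<And>i j. i \<in> M \<Longrightarrow> j \<in> M \<Longrightarrow> \<kappa> i \<le> \<kappa> j \<Longrightarrow> coord x i \<le> coord x j"
    and level: "\<And>i. i \<in> M \<Longrightarrow> (\<Sum>j\<in>{j\<in>M. \<kappa> i \<le> \<kappa> j}. coord x j)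
       \<le> (\<Sum>k=1..n. real (min (card {j\<in>M. \<kappa> i \<le> \<kappa> j}) k) * coord y k)"
  shows "(x, y) \<in> linking_polyhedron M"
proof -
  obtain \<sigma> where \<sigma>: "bij_betw \<sigma> {..<n} M" and dec: "\<And>i j. i < j \<Longrightarrow> j < n \<Longrightarrow> \<kappa> (\<sigma> j) < \<kappa> (\<sigma> i)"
    using ex_decreasing_enumeration[OF M(1) \<kappa>(1)] M(2) by metis
  have inj: "inj_on \<sigma> {..<n}" and img: "\<sigma> ` {..<n} = M"
    using \<sigma> by (auto simp: bij_betw_def)
  define z where "z = (\<Sum>k=1..n. coord y k *\<^sub>R (\<Sum>i<k. unit (\<sigma> i)))"
  have z_coord: "coord z (\<sigma> j) = (\<Sum>k=1..n. coord y k * (if j < k then 1 else 0))" if "j < n" for j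
  proof -
    have "(\<Sum>i<k. if \<sigma> i = \<sigma> j then 1 else 0) = (if j < k then 1 else (0::real))" if k: "k \<in> {1..n}" for k
    proof -
      have "(\<Sum>i<k. if \<sigma> i = \<sigma> j then 1 else 0) = (\<Sum>i<k. if i = j then 1 else (0::real))"
        using inj k \<open>j < n\<close> by (intro sum.cong) (auto dest: inj_onD)
      then show ?thesis by simp
    qed
    then show ?thesis by (simp add: z_def lookup_sum coord_scaleR lookup_single when_def)
  qed
  have z_prefix: "(\<Sum>j<s. coord z (\<sigma> j)) = (\<Sum>k=1..n. real (min s k) * coord y k)" if "s \<le> n" for s
  proof -
    have "(\<Sum>j<s. coord z (\<sigma> j)) = (\<Sum>j<s. \<Sum>k=1..n. coord y k * (if j < k then 1 else 0))"
      using that by (intro sum.cong) (auto simp: z_coord)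
    also have "\<dots> = (\<Sum>k=1..n. \<Sum>j<s. coord y k * (if j < k then 1 else 0))" by (rule sum.swap)
    also have "\<dots> = (\<Sum>k=1..n. real (min s k) * coord y k)"
    proof (intro sum.cong refl)
      fix k
      have "(\<Sum>j<s. if j < k then 1 else (0::real)) = real (card ({..<s} \<inter> {j. j < k}))"
        by (simp add: sum.If_cases)
      also have "{..<s} \<inter> {j. j < k} = {..<min s k}" by auto
      finally show "(\<Sum>j<s. coord y k * (if j < k then 1 else 0)) = real (min s k) * coord y k"
        by (simp flip: sum_distrib_left)
    qed
    finally show ?thesis .
  qed
  have x_sum: "(\<Sum>j<s. coord x (\<sigma> j)) = (\<Sum>j\<in>\<sigma> ` {..<s}. coord x j)" if "s \<le> n" for s
    using inj that by (subst sum.reindex) (auto intro: inj_on_subset)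
  show ?thesis
  proof (rule linking_polyhedron_majorization[OF M(1) \<sigma> x])
    show "(z, y) \<in> linking_polyhedron M"
      unfolding z_def using M \<sigma> y by (rule staircase_in_linking_polyhedron)
    show "Poly_Mapping.keys z \<subseteq> M"
    proof
      fix j assume "j \<in> Poly_Mapping.keys z"
      then have "(\<Sum>k=1..n. coord y k * (\<Sum>i<k. if \<sigma> i = j then 1 else 0)) \<noteq> 0"
        by (simp add: z_def lookup_sum coord_simps in_keys_iff)
      then obtain k where k: "k \<in> {1..n}" "coord y k * (\<Sum>i<k. if \<sigma> i = j then 1 else 0) \<noteq> 0"
        by (meson sum.neutral)
      have "\<exists>i<k. \<sigma> i = j"
      proof (rule ccontr)
        assume "\<not> ?thesis"
        then have "(\<Sum>i<k. if \<sigma> i = j then 1 else 0) = (0::real)" by (intro sum.neutral) auto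
        then show False using k(2) by simp
      qed
      then obtain i where "i < k" "\<sigma> i = j" by blast
      then show "j \<in> M" using k(1) img by auto
    qed
    show "coord x (\<sigma> j) \<le> coord x (\<sigma> i)" if "i < j" "j < n" for i j
      using that dec[OF that] img by (intro \<kappa>(2)) auto
    show "(\<Sum>i<n. coord x (\<sigma> i)) = (\<Sum>i<n. coord z (\<sigma> i))"
      unfolding x_sum[OF order.refl] z_prefix[OF order.refl] img total
      by (intro sum.cong) (auto simp: min_def)
    show "(\<Sum>i<s. coord x (\<sigma> i)) \<le> (\<Sum>i<s. coord z (\<sigma> i))" if "s \<le> n" for s
    proof (cases s)
      case 0
      then show ?thesis by simp
    next
      case (Suc t)
      have "\<kappa> (\<sigma> t) \<le> \<kappa> (\<sigma> i) \<longleftrightarrow> i \<le> t" if "i < n" for i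
        using dec[of i t] dec[of t i] that \<open>s \<le> n\<close> Suc by (cases i t rule: linorder_cases) auto
      then have "{j \<in> M. \<kappa> (\<sigma> t) \<le> \<kappa> j} = \<sigma> ` {..<s}"
        using Suc that unfolding img[symmetric] by fastforce
      moreover have "card (\<sigma> ` {..<s}) = s"
        using inj that by (subst card_image) (auto intro: inj_on_subset)
      moreover have "\<sigma> t \<in> M" using img Suc that by auto
      ultimately show ?thesis
        using level[of "\<sigma> t"] z_prefix[OF that] x_sum[OF that] by simp
    qed
  qed
qed

text \<open>
  For \<open>y = e_k\<close> the right-hand side is \<open>min |S| k\<close>, and \<open>x\<close> has at most \<open>|S|\<close> ones in \<open>S\<close> and \<open>k\<close> ones
  altogether.
\<close>
lemma linking_point_subset_inequality:
  fixes x y :: "nat \<Rightarrow>\<^sub>0 real"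
  assumes "(x, y) \<in> linking_points M" "finite M" "S \<subseteq> M"
  shows "(\<Sum>j\<in>S. coord x j) \<le> (\<Sum>k=1..card M. real (min (card S) k) * coord y k)"
proof -
  let ?n = "card M"
  have x: "\<And>j. j \<in> M \<Longrightarrow> coord x j \<in> {0, 1}" and y: "\<And>k. k \<in> {1..?n} \<Longrightarrow> coord y k \<in> {0, 1}"
    and total: "(\<Sum>j\<in>M. coord x j) = (\<Sum>k=1..?n. real k * coord y k)"
    and one: "(\<Sum>k=1..?n. coord y k) \<le> 1"
    using assms(1) by (auto simp: linking_points_def)
  have nonneg: "\<And>j. j \<in> M \<Longrightarrow> 0 \<le> coord x j" "\<And>k. k \<in> {1..?n} \<Longrightarrow> 0 \<le> coord y k"
    using x y by fastforce+
  have le_card: "(\<Sum>j\<in>S. coord x j) \<le> real (card S)"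
    using sum_bounded_above[of S "coord x" 1] x assms(3) by fastforce
  have le_total: "(\<Sum>j\<in>S. coord x j) \<le> (\<Sum>k=1..?n. real k * coord y k)"
    unfolding total[symmetric] using assms(2,3) nonneg by (intro sum_mono2) auto
  show ?thesis
  proof (cases "\<exists>k\<in>{1..?n}. coord y k = 1")
    case False
    then have "coord y k = 0" if "k \<in> {1..?n}" for k using y[OF that] that by auto
    then show ?thesis using le_total by simp
  next
    case True
    then obtain l where l: "l \<in> {1..?n}" "coord y l = 1" by blast
    have "coord y k = 0" if "k \<in> {1..?n}" "k \<noteq> l" for k
    proof -
      have "(\<Sum>k\<in>{k, l}. coord y k) \<le> 1"
        using one nonneg(2) that l by (intro order.trans[OF sum_mono2 one]) auto
      then show ?thesis using that l nonneg(2)[of k] by simp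
    qed
    then have y_eq: "coord y k = (if k = l then 1 else 0)" if "k \<in> {1..?n}" for k
      using that l by auto
    have collapse: "(\<Sum>k=1..?n. f k * coord y k) = f l" for f :: "nat \<Rightarrow> real"
    proof -
      have "(\<Sum>k=1..?n. f k * coord y k) = (\<Sum>k=1..?n. if k = l then f k else 0)"
        by (intro sum.cong) (auto simp: y_eq)
      then show ?thesis using l(1) by simp
    qed
    show ?thesis using le_card le_total unfolding collapse by simp
  qed
qed

section \<open>Reasoning about run time\<close>

text \<open>
  Instead of the cost of each step, an upper bound \<open>2 ^ l\<close> on all memory cells is kept as an invariant.
  A step then costs at most \<open>l\<close> times a number read off the program text, so bounding the run time
  amounts to counting steps and bounding the stored values.
\<close>
definition bounded_store :: "nat \<Rightarrow> store \<Rightarrow> bool" where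
  "bounded_store l s \<longleftrightarrow> (\<forall>b i. \<bar>s b i\<bar> \<le> 2 ^ l)"

lemma bounded_store_mono: "bounded_store l s \<Longrightarrow> l \<le> l' \<Longrightarrow> bounded_store l' s"
  unfolding bounded_store_def by (meson order.trans power_increasing one_le_numeral)

text \<open>
  If all cells are at most \<open>2 ^ l\<close>, an expression of degree \<open>d\<close> has value at most \<open>2 ^ (l * d)\<close>. A
  constant \<open>c\<close> has degree \<open>|c|\<close> because \<open>|c| \<le> 2 ^ |c|\<close>.
\<close>
fun value_degree :: "aexp \<Rightarrow> nat" where
  "value_degree (Const c) = nat \<bar>c\<bar>"
| "value_degree (Cell b a) = 1"
| "value_degree (Add a1 a2) = value_degree a1 + value_degree a2 + 1"
| "value_degree (Sub a1 a2) = value_degree a1 + value_degree a2 + 1"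
| "value_degree (Mul a1 a2) = value_degree a1 + value_degree a2"

fun aexp_work :: "aexp \<Rightarrow> nat" where
  "aexp_work (Const c) = value_degree (Const c) + 2"
| "aexp_work (Cell b a) = aexp_work a + 3"
| "aexp_work (Add a1 a2) = aexp_work a1 + aexp_work a2 + value_degree (Add a1 a2) + 2"
| "aexp_work (Sub a1 a2) = aexp_work a1 + aexp_work a2 + value_degree (Sub a1 a2) + 2"
| "aexp_work (Mul a1 a2) = aexp_work a1 + aexp_work a2 + value_degree (Mul a1 a2) + 2"

lemma int_less_power_int_size: "\<bar>z\<bar> < 2 ^ int_size z"
proof -
  have "\<bar>z\<bar> < 2 ^ nat (bitlen \<bar>z\<bar>)" using bitlen_bounds[of "\<bar>z\<bar>"] by (cases "z = 0") auto
  also have "\<dots> \<le> 2 ^ int_size z" by (intro power_increasing) (auto simp: int_size_def)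
  finally show ?thesis .
qed

lemma int_size_le: "\<bar>z\<bar> \<le> 2 ^ k \<Longrightarrow> int_size z \<le> k + 2"
proof -
  assume "\<bar>z\<bar> \<le> 2 ^ k"
  also have "(2::int) ^ k < 2 ^ nat (int (k + 1))" by (simp only: nat_int) simp
  finally have "bitlen \<bar>z\<bar> \<le> int (k + 1)" by (subst bitlen_le_iff_power) auto
  then show "int_size z \<le> k + 2" unfolding int_size_def by linarith
qed

lemma power_2_add_le:
  fixes x y :: int
  assumes "\<bar>x\<bar> \<le> 2 ^ (l * a)" "\<bar>y\<bar> \<le> 2 ^ (l * b)" "1 \<le> l"
  shows "\<bar>x\<bar> + \<bar>y\<bar> \<le> 2 ^ (l * (a + b + 1))"
proof -
  have "\<bar>x\<bar> + \<bar>y\<bar> \<le> 2 ^ (l * (a + b)) + 2 ^ (l * (a + b))"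
    using assms by (intro add_mono) (auto elim!: order.trans intro!: power_increasing)
  also have "\<dots> = 2 ^ (l * (a + b) + 1)" by simp
  also have "\<dots> \<le> 2 ^ (l * (a + b + 1))" using assms(3) by (intro power_increasing) auto
  finally show ?thesis .
qed

lemma aval_bound:
  assumes "bounded_store l s" "1 \<le> l"
  shows "\<bar>aval a s\<bar> \<le> 2 ^ (l * value_degree a)"
proof (induction a)
  case (Const c)
  have "\<bar>c\<bar> = int (nat \<bar>c\<bar>)" by simp
  also have "\<dots> \<le> 2 ^ nat \<bar>c\<bar>" using of_nat_less_two_power[of "nat \<bar>c\<bar>", where 'a = int] by linarith
  also have "\<dots> \<le> 2 ^ (l * nat \<bar>c\<bar>)" using assms(2) by (intro power_increasing) auto
  finally show ?case by simp
next
  case (Cell b a)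
  then show ?case using assms(1) by (simp add: bounded_store_def)
next
  case (Add a1 a2)
  then show ?case using power_2_add_le[OF Add assms(2)] abs_triangle_ineq by (auto intro: order.trans)
next
  case (Sub a1 a2)
  then show ?case using power_2_add_le[OF Sub assms(2)] abs_triangle_ineq4 by (auto intro: order.trans)
next
  case (Mul a1 a2)
  then show ?case by (auto simp: abs_mult distrib_left power_add intro!: mult_mono)
qed

lemma int_size_aval:
  assumes "bounded_store l s" "1 \<le> l"
  shows "int_size (aval a s) \<le> l * value_degree a + 2 * l"
  using int_size_le[OF aval_bound[OF assms, of a]] assms(2) by linarith

lemma acost_le_work:
  assumes "bounded_store l s" "1 \<le> l"
  shows "acost a s \<le> l * aexp_work a"
proof (induction a)
  case (Const c)
  show ?case using int_size_aval[OF assms, of "Const c"] by (simp add: algebra_simps)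
next
  case (Cell b a)
  then show ?case using int_size_aval[OF assms, of "Cell b a"] by (simp add: algebra_simps)
next
  case (Add a1 a2)
  then show ?case using int_size_aval[OF assms, of "Add a1 a2"] by (simp add: algebra_simps)
next
  case (Sub a1 a2)
  then show ?case using int_size_aval[OF assms, of "Sub a1 a2"] by (simp add: algebra_simps)
next
  case (Mul a1 a2)
  then show ?case using int_size_aval[OF assms, of "Mul a1 a2"] by (simp add: algebra_simps)
qed

text \<open>
  A total correctness judgement with time: \<open>m\<close> counts work in units of \<open>l\<close>.
\<close>
definition achieves :: "nat \<Rightarrow> com \<Rightarrow> nat \<Rightarrow> store \<Rightarrow> (store \<Rightarrow> bool) \<Rightarrow> bool" where
  "achieves l c m s Q \<longleftrightarrow> (\<exists>t s'. exec c s t s' \<and> t \<le> l * m \<and> bounded_store l s' \<and> Q s')"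

lemma achievesI:
  "exec c s t s' \<Longrightarrow> t \<le> l * m \<Longrightarrow> bounded_store l s' \<Longrightarrow> Q s' \<Longrightarrow> achieves l c m s Q"
  unfolding achieves_def by blast

lemma achieves_mono:
  assumes "achieves l c m s P" "\<And>s'. bounded_store l s' \<Longrightarrow> P s' \<Longrightarrow> Q s'"
  shows "achieves l c m s Q"
  using assms unfolding achieves_def by blast

text \<open>
  The work of a loop is not a function of its text: loops are treated by \<open>achieves_Loop\<close>, and the
  value 0 is a dummy.
\<close>
fun straight_work :: "com \<Rightarrow> nat" where
  "straight_work Skip = 1"
| "straight_work (Store b a e) = 1 + aexp_work a + aexp_work e"
| "straight_work (Seq c1 c2) = straight_work c1 + straight_work c2"
| "straight_work (Cond e c1 c2) = 1 + aexp_work e + straight_work c1 + straight_work c2"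
| "straight_work (Loop e c) = 0"

lemma achieves_Skip:
  assumes "bounded_store l s" "1 \<le> l" "Q s"
  shows "achieves l Skip (straight_work Skip) s Q"
  by (rule achievesI[where t = 1 and s' = s, OF exec.Skip]) (use assms in auto)

lemma achieves_Store:
  assumes "bounded_store l s" "1 \<le> l" "\<bar>aval e s\<bar> \<le> 2 ^ l"
    and Q: "bounded_store l (s(b := (s b)(aval a s := aval e s))) \<Longrightarrow> Q (s(b := (s b)(aval a s := aval e s)))"
  shows "achieves l (Store b a e) (straight_work (Store b a e)) s Q"
proof (rule achievesI)
  show "exec (Store b a e) s (1 + acost a s + acost e s) (s(b := (s b)(aval a s := aval e s)))"
    by (rule exec.Store)
  show "1 + acost a s + acost e s \<le> l * straight_work (Store b a e)"
    using acost_le_work[OF assms(1,2), of a] acost_le_work[OF assms(1,2), of e] assms(2)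
    by (simp add: algebra_simps)
  show "bounded_store l (s(b := (s b)(aval a s := aval e s)))"
    using assms(1,3) by (auto simp: bounded_store_def)
  then show "Q (s(b := (s b)(aval a s := aval e s)))" by (rule Q)
qed

lemma achieves_Seq:
  assumes "achieves l c1 m1 s (\<lambda>s'. achieves l c2 m2 s' Q)"
  shows "achieves l (Seq c1 c2) (m1 + m2) s Q"
proof -
  from assms obtain t1 s1 t2 s2 where "exec c1 s t1 s1" "t1 \<le> l * m1"
      "exec c2 s1 t2 s2" "t2 \<le> l * m2" "bounded_store l s2" "Q s2"
    unfolding achieves_def by blast
  then show ?thesis unfolding achieves_def
    by (intro exI[of _ "t1 + t2"] exI[of _ s2]) (auto simp: algebra_simps intro: exec.Seq)
qed

lemma achieves_Seq_straight:
  assumes "achieves l c1 (straight_work c1) s (\<lambda>s'. achieves l c2 (straight_work c2) s' Q)"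
  shows "achieves l (Seq c1 c2) (straight_work (Seq c1 c2)) s Q"
  using achieves_Seq[OF assms] by simp

lemma achieves_Cond:
  assumes s: "bounded_store l s" "1 \<le> l"
    and 1: "0 < aval e s \<Longrightarrow> achieves l c1 (straight_work c1) s Q"
    and 2: "\<not> 0 < aval e s \<Longrightarrow> achieves l c2 (straight_work c2) s Q"
  shows "achieves l (Cond e c1 c2) (straight_work (Cond e c1 c2)) s Q"
proof (cases "0 < aval e s")
  case True
  then obtain t s' where "exec c1 s t s'" "t \<le> l * straight_work c1" "bounded_store l s'" "Q s'"
    using 1 unfolding achieves_def by blast
  then show ?thesis using acost_le_work[OF s, of e] True s(2)
    by (intro achievesI[OF exec.CondTrue[OF True]]) (auto simp: algebra_simps)
next
  case False
  then obtain t s' where "exec c2 s t s'" "t \<le> l * straight_work c2" "bounded_store l s'" "Q s'"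
    using 2 unfolding achieves_def by blast
  then show ?thesis using acost_le_work[OF s, of e] False s(2)
    by (intro achievesI[OF exec.CondFalse[OF False]]) (auto simp: algebra_simps)
qed

definition loop_work :: "aexp \<Rightarrow> nat \<Rightarrow> nat \<Rightarrow> nat" where
  "loop_work e m i = i * (1 + aexp_work e + m) + (1 + aexp_work e)"

text \<open>
  The first argument of the invariant \<open>I\<close> bounds the number of iterations still to come. A loop may stop
  before this number reaches 0, as the search for a violated inequality does.
\<close>
lemma achieves_Loop:
  assumes l: "1 \<le> l"
    and stop: "\<And>s. I 0 s \<Longrightarrow> \<not> 0 < aval e s"
    and step: "\<And>i s. I (Suc i) s \<Longrightarrow> bounded_store l s \<Longrightarrow> 0 < aval e s \<Longrightarrow> achieves l c m s (I i)"
    and s: "I i s" "bounded_store l s"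
  shows "achieves l (Loop e c) (loop_work e m i) s (\<lambda>s'. (\<exists>j. I j s') \<and> \<not> 0 < aval e s')"
  using s
proof (induction i arbitrary: s)
  case (0 s)
  then show ?case using stop[OF 0(1)] acost_le_work[OF 0(2) l, of e] l
    by (intro achievesI[OF exec.LoopFalse]) (auto simp: algebra_simps loop_work_def)
next
  case (Suc i s)
  note cost = acost_le_work[OF Suc.prems(2) l, of e]
  show ?case
  proof (cases "0 < aval e s")
    case False
    then show ?thesis using cost l Suc.prems
      by (intro achievesI[OF exec.LoopFalse]) (auto simp: algebra_simps loop_work_def)
  next
    case True
    from step[OF Suc.prems True] obtain t1 s1
      where 1: "exec c s t1 s1" "t1 \<le> l * m" "bounded_store l s1" "I i s1"
      unfolding achieves_def by blast
    from Suc.IH[OF 1(4,3)] obtain t2 s2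
      where 2: "exec (Loop e c) s1 t2 s2" "t2 \<le> l * loop_work e m i" "bounded_store l s2"
        "\<exists>j. I j s2" "\<not> 0 < aval e s2"
      unfolding achieves_def by blast
    show ?thesis
    proof (rule achievesI)
      show "exec (Loop e c) s (1 + acost e s + t1 + t2) s2"
        using True 1(1) 2(1) by (rule exec.LoopTrue)
      show "1 + acost e s + t1 + t2 \<le> l * loop_work e m (Suc i)"
        using cost 1(2) 2(2) l by (simp add: loop_work_def algebra_simps)
    qed (use 2 in auto)
  qed
qed

section \<open>The separation program\<close>

text \<open>
  \<open>above n num den c e\<close> says that the pair \<open>(x_e, - e)\<close> is lexicographically at least \<open>(x_c, - c)\<close>, where
  \<open>x_i = num i / den i\<close>. The comparison becomes a single test of positivity because, for \<open>c, e < n\<close>, the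
  difference of the positions is smaller than \<open>n\<close> in absolute value.
\<close>
definition above :: "nat \<Rightarrow> (nat \<Rightarrow> int) \<Rightarrow> (nat \<Rightarrow> int) \<Rightarrow> nat \<Rightarrow> nat \<Rightarrow> bool" where
  "above n num den c e \<longleftrightarrow>
     0 < (num e * den c - num c * den e) * int n + (int c - int e) + 1"

text \<open>
  The coefficients of the candidate inequality number \<open>c\<close>. Coordinates are numbered as in the output:
  \<open>e < n\<close> is the position of an element of \<open>M\<close>, and \<open>e = n + k - 1\<close> stands for \<open>y_k\<close>. The candidates are,
  in this order, the level set inequalities \<open>x(S) - \<Sum>k. min |S| k * y_k \<le> 0\<close>, the inequalities
  \<open>- y_k \<le> 0\<close>, the inequality \<open>\<Sum>y \<le> 1\<close>, and \<open>\<Sum>k. k * y_k - x(M) \<le> 0\<close>.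
\<close>
definition cut_coeff :: "nat \<Rightarrow> (nat \<Rightarrow> int) \<Rightarrow> (nat \<Rightarrow> int) \<Rightarrow> nat \<Rightarrow> nat \<Rightarrow> int" where
  "cut_coeff n num den c e =
    (if c < n then
       if e < n then if above n num den c e then 1 else 0
       else - int (min (card {j. j < n \<and> above n num den c j}) (e + 1 - n))
     else if c < 2 * n then if e = c then -1 else 0
     else if c = 2 * n then if e < n then 0 else 1
     else if e < n then -1 else int (e + 1 - n))"

definition cut_rhs :: "nat \<Rightarrow> nat \<Rightarrow> int" where
  "cut_rhs n c = (if c = 2 * n then 1 else 0)"

text \<open>
  The content of the counter when entry \<open>e\<close> is reached. The entries of \<open>x\<close> precede those of \<open>y\<close>, so
  the size of the level set is known when the coefficients of \<open>y\<close> are written.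
\<close>
definition level_size :: "nat \<Rightarrow> (nat \<Rightarrow> int) \<Rightarrow> (nat \<Rightarrow> int) \<Rightarrow> nat \<Rightarrow> nat \<Rightarrow> nat" where
  "level_size n num den c e = (if c < n then card {j. j < min e n \<and> above n num den c j} else 0)"

text \<open>
  The input bank is only read. Banks 2 to 6 serve as variables, using cell 0 alone: the number of the
  current candidate, the current entry, numerator and denominator of the partial sum, and the
  counter for the level set.
\<close>
abbreviation "N_var \<equiv> Cell 0 (Const 0)"
abbreviation "verdict_var \<equiv> Cell 1 (Const 0)"
abbreviation "cut_var \<equiv> Cell 2 (Const 0)"
abbreviation "entry_var \<equiv> Cell 3 (Const 0)"
abbreviation "sum_num_var \<equiv> Cell 4 (Const 0)"
abbreviation "sum_den_var \<equiv> Cell 5 (Const 0)"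
abbreviation "level_var \<equiv> Cell 6 (Const 0)"
abbreviation "num_at a \<equiv> Cell 0 (Add (Mul (Const 2) a) (Const 1))"
abbreviation "den_at a \<equiv> Cell 0 (Add (Mul (Const 2) a) (Const 2))"
abbreviation "coeff_addr \<equiv> Add entry_var (Const 1)"
abbreviation "set_coeff a \<equiv> Store 1 coeff_addr a"
abbreviation "eq_test a b \<equiv> Sub (Const 1) (Mul (Sub a b) (Sub a b))"
abbreviation "y_index \<equiv> Sub coeff_addr N_var"

definition above_test :: aexp where
  "above_test =
     Add (Add (Mul (Sub (Mul (num_at entry_var) (den_at cut_var)) (Mul (num_at cut_var) (den_at entry_var))) N_var)
       (Sub cut_var entry_var)) (Const 1)"

definition coeff_com :: com where
  "coeff_com =
    Cond (Sub N_var cut_var)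
      (Cond (Sub N_var entry_var)
        (Cond above_test
          (Seq (set_coeff (Const 1)) (Store 6 (Const 0) (Add level_var (Const 1))))
          (set_coeff (Const 0)))
        (Cond (Sub level_var y_index)
          (set_coeff (Sub (Const 0) y_index))
          (set_coeff (Sub (Const 0) level_var))))
      (Cond (Sub (Mul (Const 2) N_var) cut_var)
        (Cond (eq_test entry_var cut_var) (set_coeff (Const (-1))) (set_coeff (Const 0)))
        (Cond (eq_test cut_var (Mul (Const 2) N_var))
          (Cond (Sub N_var entry_var) (set_coeff (Const 0)) (set_coeff (Const 1)))
          (Cond (Sub N_var entry_var) (set_coeff (Const (-1))) (set_coeff y_index))))"

definition entry_com :: com where
  "entry_com =
    Seq coeff_com
    (Seq (Store 4 (Const 0) (Add (Mul sum_num_var (den_at entry_var))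
           (Mul (Mul (Cell 1 coeff_addr) (num_at entry_var)) sum_den_var)))
    (Seq (Store 5 (Const 0) (Mul sum_den_var (den_at entry_var)))
         (Store 3 (Const 0) (Add entry_var (Const 1)))))"

definition entry_test :: aexp where
  "entry_test = Sub (Mul (Const 2) N_var) entry_var"

definition init_cut_com :: com where
  "init_cut_com =
    Seq (Store 3 (Const 0) (Const 0))
    (Seq (Store 4 (Const 0) (Const 0))
    (Seq (Store 5 (Const 0) (Const 1))
         (Store 6 (Const 0) (Const 0))))"

abbreviation "rhs_addr \<equiv> Add (Mul (Const 2) N_var) (Const 1)"

definition verdict_com :: com where
  "verdict_com =
    Seq (Cond (eq_test cut_var (Mul (Const 2) N_var)) (Store 1 rhs_addr (Const 1)) (Store 1 rhs_addr (Const 0)))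
    (Seq (Cond (Sub sum_num_var (Mul (Cell 1 rhs_addr) sum_den_var)) (Store 1 (Const 0) (Const 0)) Skip)
         (Store 2 (Const 0) (Add cut_var (Const 1))))"

definition cut_com :: com where
  "cut_com = Seq init_cut_com (Seq (Loop entry_test entry_com) verdict_com)"

text \<open>
  The factor \<open>verdict_var\<close> is 1 as long as no violated candidate has been found and 0 afterwards, when
  the loop stops and leaves the violated candidate in the output bank.
\<close>
definition cut_test :: aexp where
  "cut_test = Mul (Sub (Add (Mul (Const 2) N_var) (Const 2)) cut_var) verdict_var"

definition separation_com :: com where
  "separation_com = Seq (Store 1 (Const 0) (Const 1)) (Loop cut_test cut_com)"

definition presents :: "nat \<Rightarrow> (nat \<Rightarrow> int) \<Rightarrow> (nat \<Rightarrow> int) \<Rightarrow> store \<Rightarrow> bool" where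
  "presents n num den s \<longleftrightarrow>
     s 0 0 = int n \<and> (\<forall>e<2 * n. s 0 (2 * int e + 1) = num e \<and> s 0 (2 * int e + 2) = den e)"

lemma presents_upd [simp]: "b \<noteq> 0 \<Longrightarrow> presents n num den (s(b := f)) = presents n num den s"
  by (simp add: presents_def)

lemma level_size_Suc:
  "level_size n num den c (Suc e) =
     level_size n num den c e + (if c < n \<and> e < n \<and> above n num den c e then 1 else 0)"
proof (cases "e < n")
  case True
  then have "{j. j < min (Suc e) n \<and> above n num den c j} =
      (if above n num den c e then insert e else id) {j. j < min e n \<and> above n num den c j}"
    by (auto simp: less_Suc_eq)
  then show ?thesis using True by (simp add: level_size_def)
next
  case False
  then show ?thesis by (simp add: level_size_def min_def)
qed

lemma level_size_le: "level_size n num den c e \<le> n"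
proof -
  have "card {j. j < min e n \<and> above n num den c j} \<le> card {..<n}" by (intro card_mono) auto
  then show ?thesis by (simp add: level_size_def)
qed

lemma level_size_full: "c < n \<Longrightarrow> n \<le> e \<Longrightarrow> level_size n num den c e = card {j. j < n \<and> above n num den c j}"
  by (simp add: level_size_def min_absorb2)

lemma abs_cut_coeff_le:
  assumes "1 \<le> n" "e < 2 * n"
  shows "\<bar>cut_coeff n num den c e\<bar> \<le> int n"
proof -
  have "int (e + 1 - n) \<le> int n" using assms by linarith
  then show ?thesis using assms by (auto simp: cut_coeff_def)
qed

lemma square_less_one_iff: "(a - b) * (a - b) < 1 \<longleftrightarrow> a = (b :: int)"
proof
  assume "(a - b) * (a - b) < 1"
  moreover have "0 \<le> (a - b) * (a - b)" by simp
  ultimately have "(a - b) * (a - b) = 0" by linarith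
  then show "a = b" by simp
qed simp

lemma achieves_coeff_com:
  assumes l: "1 \<le> l" "int (2 * n + 2) \<le> 2 ^ l" and n: "1 \<le> n"
    and s: "bounded_store l s" "presents n num den s" "s 2 0 = int c" "s 3 0 = int e" "e < 2 * n"
      "s 6 0 = int (level_size n num den c e)"
    and Q: "\<And>s'. bounded_store l s' \<Longrightarrow>
      s' = s(1 := (s 1)(int e + 1 := cut_coeff n num den c e), 6 := (s 6)(0 := int (level_size n num den c (Suc e)))) \<Longrightarrow> Q s'"
  shows "achieves l coeff_com (straight_work coeff_com) s Q"
proof -
  let ?lv = "level_size n num den c e"
  have lv: "?lv \<le> n" by (rule level_size_le)
  have small: "\<bar>z\<bar> \<le> 2 ^ l" if "\<bar>z\<bar> \<le> int (2 * n + 2)" for z :: int using that l(2) by linarith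
  have N: "s 0 0 = int n" using s(2) by (simp add: presents_def)
  have test: "aval above_test s = (num e * den c - num c * den e) * int n + (int c - int e) + 1" if "c < n"
    using s that by (simp add: above_test_def presents_def)
  let ?P = "\<lambda>s'. s' = s(1 := (s 1)(int e + 1 := cut_coeff n num den c e), 6 := (s 6)(0 := int (level_size n num den c (Suc e))))"
  have six: "s 6 = (s 6)(0 := int ?lv)" using s(6) by (simp add: fun_eq_iff)
  have leaf: "achieves l (set_coeff a) (straight_work (set_coeff a)) s ?P"
    if "aval a s = cut_coeff n num den c e" "level_size n num den c (Suc e) = ?lv" for a
    using that abs_cut_coeff_le[OF n s(5), of num den c]
    by (intro achieves_Store s(1) l(1)) (auto simp: s(4) fun_eq_iff s(6) intro!: small)
  have "achieves l coeff_com (straight_work coeff_com) s ?P"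
    unfolding coeff_com_def
  proof (intro achieves_Cond[OF s(1) l(1)], goal_cases)
    case 1
    then have "c < n" "e < n" "above n num den c e" using s N by (auto simp: test above_def)
    moreover have "int ?lv + 1 \<le> 2 ^ l" using lv l(2) by linarith
    ultimately show ?case
      by (intro achieves_Seq_straight achieves_Store s(1) l(1))
        (auto simp: s N level_size_Suc cut_coeff_def fun_eq_iff intro!: small)
  qed (rule leaf; auto simp: s N test above_def square_less_one_iff level_size_Suc cut_coeff_def
      level_size_full min_def)+
  then show ?thesis by (rule achieves_mono) (rule Q)
qed

text \<open>
  The bound \<open>2 ^ l\<close> has to accommodate the fractions formed during an evaluation, whose parts are
  bounded by the first summand of \<open>l_large\<close>, and the counters and coefficients, which are at most
  \<open>2 * n + 3\<close>.
\<close>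
locale separation_input =
  fixes n :: nat and num den :: "nat \<Rightarrow> int" and l :: nat
  assumes n_pos: "1 \<le> n" and l_pos: "1 \<le> l"
    and den_pos: "e < 2 * n \<Longrightarrow> 0 < den e"
    and l_large: "int (2 * n) * int n * (\<Prod>i<2 * n. (\<bar>num i\<bar> + 1) * den i) + int (2 * n + 3) \<le> 2 ^ l"
begin

text \<open>
  A common bound for the sizes of the partial sums: with coefficients bounded by \<open>n\<close>, the numerator
  after \<open>e\<close> entries is at most \<open>e * n * height e\<close>.
\<close>
definition height :: "nat \<Rightarrow> int" where
  "height e = (\<Prod>i<e. (\<bar>num i\<bar> + 1) * den i)"

definition denominator :: "nat \<Rightarrow> int" where
  "denominator e = (\<Prod>i<e. den i)"

definition cut_lhs :: "nat \<Rightarrow> nat \<Rightarrow> rat" where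
  "cut_lhs c e = (\<Sum>i<e. of_int (cut_coeff n num den c i) * (of_int (num i) / of_int (den i)))"

lemma counter_bound: "\<bar>z\<bar> \<le> int (2 * n + 3) \<Longrightarrow> \<bar>z\<bar> \<le> 2 ^ l"
proof -
  have "0 \<le> int (2 * n) * int n * (\<Prod>i<2 * n. (\<bar>num i\<bar> + 1) * den i)"
    using den_pos by (intro mult_nonneg_nonneg prod_nonneg) (auto simp: less_imp_le)
  then show "\<bar>z\<bar> \<le> int (2 * n + 3) \<Longrightarrow> \<bar>z\<bar> \<le> 2 ^ l" using l_large by linarith
qed

lemma denominator_pos: "e \<le> 2 * n \<Longrightarrow> 0 < denominator e"
  unfolding denominator_def using den_pos by (intro prod_pos) auto

lemma denominator_le_height: "e \<le> 2 * n \<Longrightarrow> denominator e \<le> height e"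
  unfolding denominator_def height_def using den_pos by (intro prod_mono) (auto simp: less_imp_le)

lemma height_le:
  assumes "e \<le> 2 * n"
  shows "height e \<le> height (2 * n)"
proof -
  have one: "1 \<le> (\<bar>num i\<bar> + 1) * den i" if "i < 2 * n" for i
    using den_pos[OF that] mult_mono[of 1 "\<bar>num i\<bar> + 1" 1 "den i"] by simp
  have "height (2 * n) = height e * (\<Prod>i\<in>{..<2 * n} - {..<e}. (\<bar>num i\<bar> + 1) * den i)"
    unfolding height_def using assms by (subst mult.commute, intro prod.subset_diff) auto
  moreover have "1 \<le> (\<Prod>i\<in>{..<2 * n} - {..<e}. (\<bar>num i\<bar> + 1) * den i)"
    using one by (intro prod_ge_1) auto
  moreover have "0 \<le> height e" using denominator_pos[OF assms] denominator_le_height[OF assms] by linarith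
  ultimately show ?thesis using mult_left_mono[of 1 _ "height e"] by simp
qed

lemma height_bound:
  assumes "e \<le> 2 * n"
  shows "int e * int n * height e \<le> 2 ^ l" "denominator e \<le> 2 ^ l"
proof -
  have pos: "0 < height e"
    using denominator_pos[OF assms] denominator_le_height[OF assms] by linarith
  have "int e * int n * height e \<le> int (2 * n) * int n * height (2 * n)"
    using assms height_le[OF assms] pos by (intro mult_mono) auto
  also have "\<dots> \<le> 2 ^ l" using l_large by (simp add: height_def)
  finally show "int e * int n * height e \<le> 2 ^ l" .
  have "1 * height e \<le> int (2 * n) * int n * height (2 * n)"
    using n_pos height_le[OF assms] pos mult_mono[of 1 "int (2 * n)" 1 "int n"]
    by (intro mult_mono) auto
  also have "\<dots> \<le> 2 ^ l" using l_large by (simp add: height_def)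
  finally show "denominator e \<le> 2 ^ l" using denominator_le_height[OF assms] by linarith
qed

text \<open>
  The invariant of the evaluation of candidate \<open>c\<close>: the first \<open>e\<close> coefficients have been written, and
  the numbers in banks 4 and 5 form a fraction equal to the partial sum \<open>cut_lhs c e\<close>.
\<close>
definition entries_done :: "nat \<Rightarrow> nat \<Rightarrow> store \<Rightarrow> bool" where
  "entries_done c e s \<longleftrightarrow> presents n num den s \<and> s 1 0 = 1 \<and> s 2 0 = int c \<and>
     e \<le> 2 * n \<and> s 3 0 = int e \<and> (\<forall>i<e. s 1 (int i + 1) = cut_coeff n num den c i) \<and>
     of_int (s 4 0) = of_int (denominator e) * cut_lhs c e \<and> \<bar>s 4 0\<bar> \<le> int e * int n * height e \<and>
     s 5 0 = denominator e \<and> s 6 0 = int (level_size n num den c e)"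

lemma achieves_entry_com:
  assumes s: "entries_done c e s" "bounded_store l s" "e < 2 * n"
  shows "achieves l entry_com (straight_work entry_com) s (entries_done c (Suc e))"
proof -
  let ?a = "cut_coeff n num den c e"
  define p where "p = s 4 0 * den e + ?a * num e * denominator e"
  note inv = s(1)[unfolded entries_done_def]
  have num_den: "s 0 (2 * int e + 1) = num e" "s 0 (2 * int e + 2) = den e"
    using inv s(3) by (auto simp: presents_def)
  have den: "0 < den e" using den_pos[OF s(3)] .
  have D: "0 < denominator e" "denominator e \<le> height e"
    using denominator_pos denominator_le_height s(3) by auto
  have D_Suc: "denominator (Suc e) = denominator e * den e" and H_Suc: "height (Suc e) = height e * ((\<bar>num e\<bar> + 1) * den e)"
    by (simp_all add: denominator_def height_def)
  have p_bound: "\<bar>p\<bar> \<le> int (Suc e) * int n * height (Suc e)"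
  proof -
    have "\<bar>p\<bar> \<le> \<bar>s 4 0\<bar> * den e + \<bar>?a\<bar> * \<bar>num e\<bar> * denominator e"
      unfolding p_def using den D by (intro order.trans[OF abs_triangle_ineq]) (simp add: abs_mult)
    also have "\<dots> \<le> (int e * int n * height e) * ((\<bar>num e\<bar> + 1) * den e) + int n * ((\<bar>num e\<bar> + 1) * den e) * height e"
    proof (intro add_mono mult_mono)
      show "den e \<le> (\<bar>num e\<bar> + 1) * den e" using den by (simp add: algebra_simps)
      have "\<bar>num e\<bar> \<le> \<bar>num e\<bar> * den e" using den mult_left_mono[of 1 "den e" "\<bar>num e\<bar>"] by simp
      then show "\<bar>num e\<bar> \<le> (\<bar>num e\<bar> + 1) * den e" using den by (simp add: algebra_simps)
    qed (use inv den D abs_cut_coeff_le[OF n_pos s(3)] in auto)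
    also have "\<dots> = int (Suc e) * int n * height (Suc e)" by (simp add: H_Suc algebra_simps)
    finally show ?thesis .
  qed
  have p_eq: "of_int p = (of_int (denominator (Suc e)) * cut_lhs c (Suc e) :: rat)"
    using inv den D by (simp add: p_def D_Suc cut_lhs_def field_simps)
  have p_small: "\<bar>p\<bar> \<le> 2 ^ l" using p_bound height_bound(1)[of "Suc e"] s(3) by linarith
  have D_small: "\<bar>denominator e * den e\<bar> \<le> 2 ^ l"
    using height_bound(2)[of "Suc e"] denominator_pos[of "Suc e"] s(3) by (simp add: D_Suc)
  show ?thesis unfolding entry_com_def
  proof (rule achieves_Seq_straight, rule achieves_coeff_com[where n = n and c = c and e = e and num = num and den = den], goal_cases)
    case (10 s')
    have e_small: "int e + 1 \<le> 2 ^ l" using s(3) counter_bound[of "int e + 1"] by simp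
    show ?case using 10(1) s(3) inv unfolding 10(2)
      by (intro achieves_Seq_straight achieves_Store l_pos)
        (auto simp: num_den p_def[symmetric] p_small D_small e_small entries_done_def p_eq p_bound D_Suc
           less_Suc_eq simp del: of_nat_Suc)
  qed (use l_pos l_large n_pos s inv counter_bound[of "int (2 * n + 2)"] in auto)
qed

definition cut_violated :: "nat \<Rightarrow> bool" where
  "cut_violated c \<longleftrightarrow> of_int (cut_rhs n c) < cut_lhs c (2 * n)"

definition outputs_cut :: "nat \<Rightarrow> store \<Rightarrow> bool" where
  "outputs_cut c s \<longleftrightarrow> (\<forall>i<2 * n. s 1 (int i + 1) = cut_coeff n num den c i) \<and>
     s 1 (2 * int n + 1) = cut_rhs n c"

definition cuts_tried :: "nat \<Rightarrow> store \<Rightarrow> bool" where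
  "cuts_tried c s \<longleftrightarrow> presents n num den s \<and> c \<le> 2 * n + 2 \<and> s 2 0 = int c \<and>
     (s 1 0 = 1 \<and> (\<forall>c'<c. \<not> cut_violated c') \<or>
      s 1 0 = 0 \<and> (\<exists>c'<2 * n + 2. outputs_cut c' s \<and> cut_violated c'))"

lemma achieves_init_cut_com:
  assumes s: "bounded_store l s" "cuts_tried c s" "s 1 0 = 1"
  shows "achieves l init_cut_com (straight_work init_cut_com) s (entries_done c 0)"
  unfolding init_cut_com_def using s(2,3)
  by (intro achieves_Seq_straight achieves_Store s(1) l_pos)
    (auto simp: entries_done_def cuts_tried_def denominator_def cut_lhs_def level_size_def intro!: counter_bound)

lemma achieves_entry_loop:
  assumes s: "bounded_store l s" "entries_done c 0 s"
  shows "achieves l (Loop entry_test entry_com) (loop_work entry_test (straight_work entry_com) (2 * n)) s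
    (entries_done c (2 * n))"
proof -
  let ?I = "\<lambda>i s. i \<le> 2 * n \<and> entries_done c (2 * n - i) s"
  have test: "aval entry_test s = 2 * int n - int e" if "entries_done c e s" for e s
    using that by (simp add: entry_test_def entries_done_def presents_def)
  have "achieves l (Loop entry_test entry_com) (loop_work entry_test (straight_work entry_com) (2 * n)) s
    (\<lambda>s'. (\<exists>j. ?I j s') \<and> \<not> 0 < aval entry_test s')"
  proof (rule achieves_Loop[where I = ?I, OF l_pos])
    fix i s assume I: "?I (Suc i) s" "bounded_store l s"
    then have "achieves l entry_com (straight_work entry_com) s (entries_done c (Suc (2 * n - Suc i)))"
      by (intro achieves_entry_com) auto
    moreover have "Suc (2 * n - Suc i) = 2 * n - i" using I(1) by linarith
    ultimately show "achieves l entry_com (straight_work entry_com) s (?I i)"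
      using I by simp
  qed (use s test in auto)
  then show ?thesis
  proof (rule achieves_mono)
    fix s' assume "(\<exists>j. ?I j s') \<and> \<not> 0 < aval entry_test s'"
    then obtain j where j: "j \<le> 2 * n" "entries_done c (2 * n - j) s'" "\<not> 0 < aval entry_test s'" by blast
    then have "j = 0" using test[OF j(2)] by simp
    then show "entries_done c (2 * n) s'" using j by simp
  qed
qed

lemma achieves_verdict_com:
  assumes s: "bounded_store l s" "entries_done c (2 * n) s" "c < 2 * n + 2"
    and tried: "\<forall>c'<c. \<not> cut_violated c'"
  shows "achieves l verdict_com (straight_work verdict_com) s (cuts_tried (Suc c))"
proof -
  note inv = s(2)[unfolded entries_done_def]
  have N: "s 0 0 = int n" using inv by (simp add: presents_def)
  have D: "0 < denominator (2 * n)" by (rule denominator_pos) simp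
  have "of_int (cut_rhs n c * denominator (2 * n)) < (of_int (s 4 0) :: rat) \<longleftrightarrow> cut_violated c"
    using inv D by (simp add: cut_violated_def mult.commute)
  then have violated: "cut_rhs n c * denominator (2 * n) < s 4 0 \<longleftrightarrow> cut_violated c"
    by (simp only: of_int_less_iff)
  let ?s = "s(1 := (s 1)(2 * int n + 1 := cut_rhs n c))"
  have c_small: "int c + 1 \<le> 2 ^ l" using s(3) counter_bound[of "int c + 1"] by simp
  have less_Suc: "\<not> cut_violated c \<Longrightarrow> \<forall>c'<Suc c. \<not> cut_violated c'"
    using tried less_Suc_eq by auto
  have out: "outputs_cut c (?s(1 := (?s 1)(0 := 0)))" using inv by (auto simp: outputs_cut_def)
  have rest: "achieves l (Seq (Cond (Sub sum_num_var (Mul (Cell 1 rhs_addr) sum_den_var)) (Store 1 (Const 0) (Const 0)) Skip)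
         (Store 2 (Const 0) (Add cut_var (Const 1))))
      (straight_work (Seq (Cond (Sub sum_num_var (Mul (Cell 1 rhs_addr) sum_den_var)) (Store 1 (Const 0) (Const 0)) Skip)
         (Store 2 (Const 0) (Add cut_var (Const 1))))) ?s (cuts_tried (Suc c))"
    if "bounded_store l ?s"
  proof (rule achieves_Seq_straight, rule achieves_Cond[OF that l_pos], goal_cases)
    case 1
    then have "cut_violated c" using inv N violated by simp
    then show ?case using inv s(3) N out
      by (intro achieves_Store that l_pos)
        (auto simp: cuts_tried_def outputs_cut_def c_small intro!: exI[of _ c])
  next
    case 2
    then have "\<not> cut_violated c" using inv N violated by simp
    then show ?case using inv s(3) N less_Suc
      by (intro achieves_Skip achieves_Store that l_pos) (auto simp: cuts_tried_def c_small)
  qed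
  show ?thesis unfolding verdict_com_def
  proof (rule achieves_Seq_straight, rule achieves_Cond[OF s(1) l_pos], goal_cases)
    case 1
    then have "cut_rhs n c = 1" using inv N by (simp add: square_less_one_iff cut_rhs_def)
    then show ?case using rest N by (intro achieves_Store[OF s(1) l_pos]) auto
  next
    case 2
    then have "cut_rhs n c = 0" using inv N by (auto simp: square_less_one_iff cut_rhs_def)
    then show ?case using rest N by (intro achieves_Store[OF s(1) l_pos]) auto
  qed
qed

definition cut_work :: nat where
  "cut_work = straight_work init_cut_com +
     (loop_work entry_test (straight_work entry_com) (2 * n) + straight_work verdict_com)"

lemma achieves_cut_com:
  assumes "bounded_store l s" "cuts_tried c s" "s 1 0 = 1" "c < 2 * n + 2"
  shows "achieves l cut_com cut_work s (cuts_tried (Suc c))"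
  unfolding cut_com_def cut_work_def
proof (rule achieves_Seq, rule achieves_mono[OF achieves_init_cut_com[OF assms(1-3)]])
  fix s1 assume "bounded_store l s1" "entries_done c 0 s1"
  then show "achieves l (Seq (Loop entry_test entry_com) verdict_com)
      (loop_work entry_test (straight_work entry_com) (2 * n) + straight_work verdict_com) s1 (cuts_tried (Suc c))"
    using assms
    by (intro achieves_Seq achieves_mono[OF achieves_entry_loop] achieves_verdict_com)
      (auto simp: cuts_tried_def)
qed

definition separation_work :: nat where
  "separation_work = straight_work (Store 1 (Const 0) (Const 1)) + loop_work cut_test cut_work (2 * n + 2)"

lemma achieves_separation_com:
  assumes s: "bounded_store l s" "presents n num den s" "s 2 0 = 0"
  shows "achieves l separation_com separation_work s (\<lambda>s'.
    s' 1 0 = 1 \<and> (\<forall>c<2 * n + 2. \<not> cut_violated c) \<or>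
    s' 1 0 = 0 \<and> (\<exists>c<2 * n + 2. outputs_cut c s' \<and> cut_violated c))"
  unfolding separation_com_def separation_work_def
proof (intro achieves_Seq achieves_Store s(1) l_pos)
  show "\<bar>aval (Const 1) s\<bar> \<le> 2 ^ l" by simp
  let ?s = "s(1 := (s 1)(aval (Const 0) s := aval (Const 1) s))"
  let ?I = "\<lambda>i s. i \<le> 2 * n + 2 \<and> cuts_tried (2 * n + 2 - i) s"
  have test: "aval cut_test s = (2 * int n + 2 - int c) * s 1 0" if "cuts_tried c s" for c s
    using that by (simp add: cut_test_def cuts_tried_def presents_def)
  assume b: "bounded_store l ?s"
  have "achieves l (Loop cut_test cut_com) (loop_work cut_test cut_work (2 * n + 2)) ?s
    (\<lambda>s'. (\<exists>j. ?I j s') \<and> \<not> 0 < aval cut_test s')"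
  proof (rule achieves_Loop[where I = ?I, OF l_pos])
    fix i s assume I: "?I (Suc i) s" "bounded_store l s" "0 < aval cut_test s"
    have "s 1 0 \<noteq> 0" using I(1,3) test[of "2 * n + 2 - Suc i" s] by auto
    then have "s 1 0 = 1" using I(1) by (auto simp: cuts_tried_def)
    with I have "achieves l cut_com cut_work s (cuts_tried (Suc (2 * n + 2 - Suc i)))"
      by (intro achieves_cut_com) auto
    moreover have "Suc (2 * n + 2 - Suc i) = 2 * n + 2 - i" using I(1) by linarith
    ultimately show "achieves l cut_com cut_work s (?I i)" using I by simp
  next
    fix s assume "?I 0 s"
    then show "\<not> 0 < aval cut_test s" using test[of "2 * n + 2" s] by simp
  next
    show "?I (2 * n + 2) ?s" using s by (simp add: cuts_tried_def)
  qed (rule b)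
  then show "achieves l (Loop cut_test cut_com) (loop_work cut_test cut_work (2 * n + 2)) ?s (\<lambda>s'.
    s' 1 0 = 1 \<and> (\<forall>c<2 * n + 2. \<not> cut_violated c) \<or>
    s' 1 0 = 0 \<and> (\<exists>c<2 * n + 2. outputs_cut c s' \<and> cut_violated c))"
  proof (rule achieves_mono)
    fix s' assume "(\<exists>j. ?I j s') \<and> \<not> 0 < aval cut_test s'"
    then obtain j where j: "j \<le> 2 * n + 2" "cuts_tried (2 * n + 2 - j) s'" "\<not> 0 < aval cut_test s'" by blast
    have "j = 0" if "s' 1 0 = 1" using test[OF j(2)] j that by simp
    then show "s' 1 0 = 1 \<and> (\<forall>c<2 * n + 2. \<not> cut_violated c) \<or>
        s' 1 0 = 0 \<and> (\<exists>c<2 * n + 2. outputs_cut c s' \<and> cut_violated c)"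
      using j(2) by (auto simp: cuts_tried_def)
  qed
qed

end

section \<open>The candidate inequalities\<close>

definition entry :: "nat list \<Rightarrow> 'k::zero point \<Rightarrow> nat \<Rightarrow> 'k" where
  "entry ms z e = (if e < length ms then coord (fst z) (ms ! e) else coord (snd z) (e + 1 - length ms))"

lemma sum_entries:
  fixes f :: "nat \<Rightarrow> 'a::comm_monoid_add"
  shows "(\<Sum>e<2 * n. f e) = (\<Sum>i<n. f i) + (\<Sum>k=1..n. f (n + k - 1))"
proof -
  have "(\<Sum>e<2 * n. f e) = (\<Sum>i<n. f i) + (\<Sum>i=n..<2 * n. f i)"
    by (subst sum.union_disjoint[symmetric]) (auto intro!: sum.cong)
  also have "(\<Sum>i=n..<2 * n. f i) = (\<Sum>k=1..n. f (n + k - 1))"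
    by (rule sum.reindex_bij_witness[of _ "\<lambda>k. n + k - 1" "\<lambda>i. i + 1 - n"]) auto
  finally show ?thesis .
qed

definition level_set :: "nat list \<Rightarrow> (nat \<Rightarrow> int) \<Rightarrow> (nat \<Rightarrow> int) \<Rightarrow> nat \<Rightarrow> nat set" where
  "level_set ms num den c = (!) ms ` {j. j < length ms \<and> above (length ms) num den c j}"

definition cut_value :: "nat list \<Rightarrow> (nat \<Rightarrow> int) \<Rightarrow> (nat \<Rightarrow> int) \<Rightarrow> nat \<Rightarrow> real point \<Rightarrow> real" where
  "cut_value ms num den c v =
     (\<Sum>e<2 * length ms. of_int (cut_coeff (length ms) num den c e) * entry ms v e)"

lemma entry_y: "k \<in> {1..length ms} \<Longrightarrow> entry ms v (length ms + k - 1) = coord (snd v) k"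
  by (auto simp: entry_def)

lemma sum_nth_set:
  "distinct ms \<Longrightarrow> (\<Sum>i<length ms. f (ms ! i)) = (\<Sum>j\<in>set ms. f j)"
  by (rule sum.reindex_bij_betw[OF bij_betw_nth]) auto

lemma satisfies_output_iff:
  "satisfies_output ms s v \<longleftrightarrow>
     (\<Sum>e<2 * length ms. of_int (s 1 (int e + 1)) * entry ms v e) \<le> of_int (s 1 (2 * int (length ms) + 1))"
proof -
  have "(\<Sum>k=1..length ms. of_int (s 1 (int (length ms + k - 1) + 1)) * entry ms v (length ms + k - 1))
      = (\<Sum>k=1..length ms. of_int (s 1 (int (length ms + k))) * coord (snd v) k)"
  proof (rule sum.cong[OF refl])
    fix k assume k: "k \<in> {1..length ms}"
    then have "int (length ms + k - 1) + 1 = int (length ms + k)" by auto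
    then show "of_int (s 1 (int (length ms + k - 1) + 1)) * entry ms v (length ms + k - 1) =
        of_int (s 1 (int (length ms + k))) * coord (snd v) k"
      by (simp only: entry_y[OF k])
  qed
  moreover have "(\<Sum>i<length ms. of_int (s 1 (int i + 1)) * entry ms v i)
      = (\<Sum>i<length ms. of_int (s 1 (int i + 1)) * coord (fst v) (ms ! i))"
    by (simp add: entry_def)
  ultimately show ?thesis by (simp only: satisfies_output_def sum_entries)
qed

lemma cut_value_eq:
  fixes u v :: "nat \<Rightarrow>\<^sub>0 real"
  assumes ms: "distinct ms" and n: "n = length ms" and c: "c < 2 * n + 2"
  shows "cut_value ms num den c (u, v) =
    (if c < n then (\<Sum>j\<in>level_set ms num den c. coord u j)
         - (\<Sum>k=1..n. real (min (card (level_set ms num den c)) k) * coord v k)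
     else if c < 2 * n then - coord v (c + 1 - n)
     else if c = 2 * n then (\<Sum>k=1..n. coord v k)
     else (\<Sum>k=1..n. real k * coord v k) - (\<Sum>j\<in>set ms. coord u j))"
proof -
  have split: "cut_value ms num den c (u, v) =
      (\<Sum>i<n. of_int (cut_coeff n num den c i) * coord u (ms ! i)) +
      (\<Sum>k=1..n. of_int (cut_coeff n num den c (n + k - 1)) * coord v k)"
    unfolding cut_value_def n[symmetric] sum_entries
    by (intro arg_cong2[of _ _ _ _ "(+)"] sum.cong) (auto simp: entry_def n)
  consider "c < n" | "n \<le> c" "c < 2 * n" | "c = 2 * n" | "c = 2 * n + 1" using c by linarith
  then show ?thesis
  proof cases
    case 1
    let ?A = "{j. j < n \<and> above n num den c j}"
    have inj: "inj_on ((!) ms) ?A" using ms n by (intro inj_on_nth) auto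
    have card: "card (level_set ms num den c) = card ?A"
      using inj by (simp add: level_set_def n card_image)
    have "(\<Sum>i<n. of_int (cut_coeff n num den c i) * coord u (ms ! i))
        = (\<Sum>i<n. if above n num den c i then coord u (ms ! i) else 0)"
      using 1 by (intro sum.cong) (auto simp: cut_coeff_def)
    also have "\<dots> = (\<Sum>i\<in>?A. coord u (ms ! i))"
      by (simp add: sum.inter_filter[symmetric])
    also have "\<dots> = (\<Sum>j\<in>level_set ms num den c. coord u j)"
      unfolding level_set_def n[symmetric] using inj by (simp add: sum.reindex)
    finally have x: "(\<Sum>i<n. of_int (cut_coeff n num den c i) * coord u (ms ! i)) = \<dots>" .
    have "(\<Sum>k=1..n. of_int (cut_coeff n num den c (n + k - 1)) * coord v k)
        = (\<Sum>k=1..n. - (real (min (card ?A) k) * coord v k))"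
      using 1 by (intro sum.cong) (auto simp: cut_coeff_def)
    then show ?thesis using 1 x by (simp add: split card sum_negf)
  next
    case 2
    have "(\<Sum>i<n. of_int (cut_coeff n num den c i) * coord u (ms ! i)) = 0"
      using 2 by (intro sum.neutral) (auto simp: cut_coeff_def)
    moreover have "(\<Sum>k=1..n. of_int (cut_coeff n num den c (n + k - 1)) * coord v k)
        = (\<Sum>k=1..n. if k = c + 1 - n then - coord v k else 0)"
      using 2 by (intro sum.cong) (auto simp: cut_coeff_def)
    moreover have "c + 1 - n \<in> {1..n}" using 2 by auto
    ultimately show ?thesis using 2 by (simp add: split)
  next
    case 3
    have "(\<Sum>i<n. of_int (cut_coeff n num den c i) * coord u (ms ! i)) = 0"
      using 3 by (intro sum.neutral) (auto simp: cut_coeff_def)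
    moreover have "(\<Sum>k=1..n. of_int (cut_coeff n num den c (n + k - 1)) * coord v k) = (\<Sum>k=1..n. coord v k)"
      using 3 by (intro sum.cong) (auto simp: cut_coeff_def)
    ultimately show ?thesis unfolding split using 3 by simp
  next
    case 4
    have "(\<Sum>i<n. of_int (cut_coeff n num den c i) * coord u (ms ! i)) = (\<Sum>i<n. - coord u (ms ! i))"
      using 4 by (intro sum.cong) (auto simp: cut_coeff_def)
    moreover have "(\<Sum>k=1..n. of_int (cut_coeff n num den c (n + k - 1)) * coord v k) = (\<Sum>k=1..n. real k * coord v k)"
      using 4 by (intro sum.cong) (auto simp: cut_coeff_def)
    ultimately show ?thesis
      unfolding split using 4 sum_nth_set[OF ms, of "coord u", folded n] by (simp add: sum_negf)
  qed
qed

text \<open>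
  Validity for the polyhedron thus reduces to validity for the points that span it.
\<close>
lemma convex_cut: "convex {v. cut_value ms num den c v \<le> r}"
proof -
  have lin: "linear (cut_value ms num den c)"
    by (rule linearI)
      (auto simp: cut_value_def entry_def coord_simps sum.distrib sum_distrib_left algebra_simps
        simp flip: sum.distrib intro!: sum.cong)
  have "{v. cut_value ms num den c v \<le> r} = cut_value ms num den c -` {..r}" by auto
  then show ?thesis using convex_linear_vimage[OF lin, of "{..r}"] by simp
qed

lemma cut_valid:
  assumes ms: "distinct ms" "set ms = M" and c: "c < 2 * length ms + 2"
    and v: "v \<in> linking_polyhedron M"
  shows "cut_value ms num den c v \<le> of_int (cut_rhs (length ms) c)"
proof -
  define n where "n = length ms"
  have card: "card M = n" using ms distinct_card n_def by blast
  have fin: "finite M" using ms(2) by auto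
  have "cut_value ms num den c (x, y) \<le> of_int (cut_rhs n c)" if L: "(x, y) \<in> linking_points M" for x y
  proof -
    have "\<And>k. k \<in> {1..n} \<Longrightarrow> coord y k \<in> {0, 1}" and one: "(\<Sum>k=1..n. coord y k) \<le> 1"
      and total: "(\<Sum>j\<in>M. coord x j) = (\<Sum>k=1..n. real k * coord y k)"
      using L card by (auto simp: linking_points_def)
    then have y: "\<And>k. k \<in> {1..n} \<Longrightarrow> 0 \<le> coord y k" by fastforce
    have "level_set ms num den c \<subseteq> M" using ms(2) by (auto simp: level_set_def)
    note sub = linking_point_subset_inequality[OF L fin this, unfolded card]
    have "0 \<le> coord y (c + 1 - n)" if "n \<le> c" "c < 2 * n" using that by (intro y) auto
    then show ?thesis
      using sub one total c unfolding cut_value_eq[OF ms(1) n_def c[folded n_def]]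
      by (auto simp: cut_rhs_def ms(2))
  qed
  then have "linking_polyhedron M \<subseteq> {v. cut_value ms num den c v \<le> of_int (cut_rhs n c)}"
    unfolding linking_polyhedron_def by (intro hull_minimal convex_cut) auto
  then show ?thesis using v by (auto simp: n_def)
qed

lemma lexicographic_pos_iff:
  fixes a :: int
  assumes "c < n" "e < n"
  shows "0 < a * int n + (int c - int e) + 1 \<longleftrightarrow> 0 < a \<or> a = 0 \<and> e \<le> c"
proof -
  consider "a \<ge> 1" | "a = 0" | "a \<le> -1" by linarith
  then show ?thesis
  proof cases
    case 1
    then have "1 * int n \<le> a * int n" by (intro mult_right_mono) auto
    then show ?thesis using 1 assms by linarith
  next
    case 3
    then have "a * int n \<le> -1 * int n" by (intro mult_right_mono) auto
    then have "a * int n + (int c - int e) + 1 \<le> 0" using assms by linarith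
    then show ?thesis using 3 by linarith
  qed auto
qed

text \<open>
  The program compares fractions by cross multiplication, while \<open>in_linking_polyhedronI\<close> expects an
  integer key. A common denominator translates between the two.
\<close>
lemma ex_common_denominator:
  fixes num den :: "nat \<Rightarrow> int"
  assumes "\<And>e. e < n \<Longrightarrow> 0 < den e"
  obtains D :: int and X :: "nat \<Rightarrow> int" where "0 < D" "\<And>e. e < n \<Longrightarrow> X e * den e = num e * D"
proof
  show "0 < (\<Prod>i<n. den i)" using assms by (intro prod_pos) auto
  show "(num e * (\<Prod>i\<in>{..<n} - {e}. den i)) * den e = num e * (\<Prod>i<n. den i)" if "e < n" for e
    using that by (subst (2) prod.remove[of _ e]) auto
qed

lemma same_sign:
  fixes a b p q :: int
  assumes "a * p = b * q" "0 < p" "0 < q"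
  shows "0 < a \<longleftrightarrow> 0 < b" "a = 0 \<longleftrightarrow> b = 0"
proof -
  have "0 < a * p \<longleftrightarrow> 0 < a" "0 < b * q \<longleftrightarrow> 0 < b" "a * p = 0 \<longleftrightarrow> a = 0" "b * q = 0 \<longleftrightarrow> b = 0"
    using assms(2,3) by (auto simp: zero_less_mult_iff)
  then show "0 < a \<longleftrightarrow> 0 < b" "a = 0 \<longleftrightarrow> b = 0" using assms(1) by simp_all
qed

text \<open>
  The key \<open>X j * n - j\<close>, with \<open>X\<close> the numerators over a common denominator, induces the order that is
  tested by \<open>above\<close>; hence the level sets of the program are those of the key. The level set of an
  element with the smallest key is \<open>M\<close>, which yields \<open>x(M) \<le> \<Sum>k. k * y_k\<close>.
\<close>
lemma cuts_complete:
  fixes x y :: "nat \<Rightarrow>\<^sub>0 real"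
  assumes ms: "distinct ms" "set ms = M" and n: "n = length ms"
    and keys: "Poly_Mapping.keys x \<subseteq> M" "Poly_Mapping.keys y \<subseteq> {1..n}"
    and den: "\<And>e. e < n \<Longrightarrow> 0 < den e"
    and x: "\<And>e. e < n \<Longrightarrow> coord x (ms ! e) = of_int (num e) / of_int (den e)"
    and cuts: "\<And>c. c < 2 * n + 2 \<Longrightarrow> cut_value ms num den c (x, y) \<le> of_int (cut_rhs n c)"
    and n_pos: "1 \<le> n"
  shows "(x, y) \<in> linking_polyhedron M"
proof -
  have card: "card M = n" using ms distinct_card n by blast
  have fin: "finite M" using ms(2) by auto
  obtain D X where D: "0 < D" and X: "\<And>e. e < n \<Longrightarrow> X e * den e = num e * D"
    using ex_common_denominator[where n = n and den = den and num = num] den by blast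
  have coord_X: "coord x (ms ! e) = of_int (X e) / of_int D" if "e < n" for e
  proof -
    have "of_int (X e) * of_int (den e) = (of_int (num e) * of_int D :: real)"
      using X[OF that] by (metis of_int_mult)
    then show ?thesis using x[OF that] den[OF that] D by (simp add: frac_eq_eq)
  qed
  have cross: "(0 < num e * den c - num c * den e \<longleftrightarrow> 0 < X e - X c)"
    "(num e * den c - num c * den e = 0 \<longleftrightarrow> X e - X c = 0)" if "e < n" "c < n" for e c
  proof -
    have "(num e * den c - num c * den e) * D = (X e - X c) * (den e * den c)"
      using X[OF that(1)] X[OF that(2)] by (simp add: algebra_simps)
    moreover have "0 < den e * den c" using den that by simp
    ultimately show "(0 < num e * den c - num c * den e \<longleftrightarrow> 0 < X e - X c)"
      "(num e * den c - num c * den e = 0 \<longleftrightarrow> X e - X c = 0)"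
      using same_sign D by blast+
  qed
  define pos where "pos = inv_into {..<n} ((!) ms)"
  have inj: "inj_on ((!) ms) {..<n}" using ms n by (intro inj_on_nth) auto
  have pos: "pos (ms ! e) = e" if "e < n" for e
    using inv_into_f_f[OF inj] that by (simp add: pos_def)
  have img: "M = (!) ms ` {..<n}" using ms(2) n by (auto simp: set_conv_nth)
  then have ex_pos: "\<exists>e<n. j = ms ! e" if "j \<in> M" for j using that by auto
  define \<kappa> where "\<kappa> j = X (pos j) * int n - int (pos j)" for j
  have \<kappa>_iff: "\<kappa> (ms ! c) \<le> \<kappa> (ms ! e) \<longleftrightarrow> X c < X e \<or> X e = X c \<and> e \<le> c" if "c < n" "e < n" for c e
  proof -
    have "\<kappa> (ms ! c) \<le> \<kappa> (ms ! e) \<longleftrightarrow> 0 < (X e - X c) * int n + (int c - int e) + 1"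
      using that by (simp add: \<kappa>_def pos algebra_simps) linarith
    then show ?thesis using lexicographic_pos_iff[OF that, of "X e - X c"] by simp
  qed
  have above_iff: "above n num den c e \<longleftrightarrow> \<kappa> (ms ! c) \<le> \<kappa> (ms ! e)" if "c < n" "e < n" for c e
    using \<kappa>_iff[OF that] cross[OF that(2,1)] lexicographic_pos_iff[OF that, of "num e * den c - num c * den e"]
    by (simp add: above_def)
  have level: "level_set ms num den c = {j \<in> M. \<kappa> (ms ! c) \<le> \<kappa> j}" if "c < n" for c
    unfolding level_set_def n[symmetric] img using above_iff[OF that] by auto
  note val = cut_value_eq[OF ms(1) n, of _ num den x y]
  note cut = cuts[unfolded cut_rhs_def]
  show ?thesis
  proof (rule in_linking_polyhedronI[OF fin card keys])
    show "0 \<le> coord y k" if "k \<in> {1..n}" for k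
    proof -
      define c where "c = n + k - 1"
      have "c < 2 * n + 2" "\<not> c < n" "c < 2 * n" "c + 1 - n = k" using that by (auto simp: c_def)
      then show ?thesis using cut[of c] val[of c] by auto
    qed
    show "(\<Sum>k=1..n. coord y k) \<le> 1" using cut[of "2 * n"] val[of "2 * n"] by simp
    show "inj_on \<kappa> M"
    proof (rule inj_onI)
      fix i j assume ij: "i \<in> M" "j \<in> M" "\<kappa> i = \<kappa> j"
      obtain c e where ce: "c < n" "e < n" "i = ms ! c" "j = ms ! e" using ex_pos ij(1,2) by blast
      have "\<kappa> (ms ! c) \<le> \<kappa> (ms ! e)" "\<kappa> (ms ! e) \<le> \<kappa> (ms ! c)" using ij(3) ce by auto
      then have "c = e" using \<kappa>_iff ce by auto
      then show "i = j" using ce by simp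
    qed
    show "coord x i \<le> coord x j" if ij: "i \<in> M" "j \<in> M" "\<kappa> i \<le> \<kappa> j" for i j
    proof -
      obtain c e where ce: "c < n" "e < n" "i = ms ! c" "j = ms ! e" using ex_pos ij(1,2) by blast
      then have "X c \<le> X e" using \<kappa>_iff[of c e] ij(3) by auto
      then show ?thesis using ce coord_X D by (simp add: divide_right_mono)
    qed
    have levels: "(\<Sum>j\<in>{j\<in>M. \<kappa> i \<le> \<kappa> j}. coord x j)
       \<le> (\<Sum>k=1..n. real (min (card {j\<in>M. \<kappa> i \<le> \<kappa> j}) k) * coord y k)" if "i \<in> M" for i
    proof -
      obtain c where "c < n" "i = ms ! c" using ex_pos[OF \<open>i \<in> M\<close>] by blast
      then show ?thesis using cut[of c] val[of c] level[of c] by simp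
    qed
    then show "(\<Sum>j\<in>{j\<in>M. \<kappa> i \<le> \<kappa> j}. coord x j)
       \<le> (\<Sum>k=1..n. real (min (card {j\<in>M. \<kappa> i \<le> \<kappa> j}) k) * coord y k)" if "i \<in> M" for i
      using that .
    have "\<kappa> ` M \<noteq> {}" "finite (\<kappa> ` M)" using n_pos card fin by auto
    then obtain m where m: "m \<in> M" "\<kappa> m = Min (\<kappa> ` M)" using Min_in by (metis imageE)
    then have "{j\<in>M. \<kappa> m \<le> \<kappa> j} = M" using fin by auto
    moreover have "(\<Sum>k=1..n. real (min n k) * coord y k) = (\<Sum>k=1..n. real k * coord y k)"
      by (intro sum.cong) auto
    ultimately have "(\<Sum>j\<in>M. coord x j) \<le> (\<Sum>k=1..n. real k * coord y k)"
      using levels[OF m(1)] card by simp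
    moreover have "(\<Sum>k=1..n. real k * coord y k) \<le> (\<Sum>j\<in>M. coord x j)"
      using cut[of "2 * n + 1"] val[of "2 * n + 1"] ms(2) by simp
    ultimately show "(\<Sum>j\<in>M. coord x j) = (\<Sum>k=1..n. real k * coord y k)" by simp
  qed
qed

section \<open>Input encoding and polynomial run time\<close>

lemma nth_concat_pairs:
  "i < length xs \<Longrightarrow> concat (map (\<lambda>x. [f x, g x]) xs) ! (2 * i) = f (xs ! i)"
  "i < length xs \<Longrightarrow> concat (map (\<lambda>x. [f x, g x]) xs) ! (2 * i + 1) = g (xs ! i)"
proof (induction xs arbitrary: i)
  case (Cons x xs)
  { case 1 then show ?case using Cons(1)[of "i - 1"] by (cases i) auto }
  { case 2 then show ?case using Cons(2)[of "i - 1"] by (cases i) auto }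
qed auto

lemma input_code_eq:
  "input_code ms z = int (length ms) # concat (map rat_code (map (entry ms z) [0..<2 * length ms]))"
proof -
  let ?n = "length ms"
  have "map (entry ms z) [0..<2 * ?n] = map (entry ms z) [0..<?n] @ map (entry ms z) [?n..<2 * ?n]"
    using upt_add_eq_append[of 0 ?n ?n] by (simp add: mult_2)
  also have "map (entry ms z) [0..<?n] = map (coord (fst z)) ms"
    by (rule nth_equalityI) (auto simp: entry_def)
  also have "map (entry ms z) [?n..<2 * ?n] = map (coord (snd z)) [1..<Suc ?n]"
    by (rule nth_equalityI) (auto simp: entry_def simp del: upt_Suc)
  finally show ?thesis by (simp add: input_code_def comp_def del: upt_Suc)
qed

lemma input_size_eq:
  assumes "distinct ms"
  shows "input_size ms z = length ms + (\<Sum>e<2 * length ms. rat_size (entry ms z e))"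
proof -
  have "(\<Sum>k=1..length ms. rat_size (entry ms z (length ms + k - 1))) = (\<Sum>k=1..length ms. rat_size (coord (snd z) k))"
    by (intro sum.cong) (auto simp: entry_def)
  moreover have "(\<Sum>i<length ms. rat_size (entry ms z i)) = (\<Sum>j\<in>set ms. rat_size (coord (fst z) j))"
    by (simp add: entry_def sum_nth_set[OF assms, of "\<lambda>j. rat_size (coord (fst z) j)"])
  ultimately show ?thesis by (simp only: input_size_def sum_entries add.assoc)
qed

lemma length_input_code: "length (input_code ms z) = 4 * length ms + 1"
  by (simp add: input_code_eq length_concat comp_def rat_code_def sum_list_triv)

lemma presents_input_store:
  "presents (length ms) (\<lambda>e. fst (quotient_of (entry ms z e))) (\<lambda>e. snd (quotient_of (entry ms z e)))
     (input_store ms z)"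
proof -
  let ?c = "concat (map rat_code (map (entry ms z) [0..<2 * length ms]))"
  have "input_store ms z 0 (2 * int e + 1) = fst (quotient_of (entry ms z e))"
    "input_store ms z 0 (2 * int e + 2) = snd (quotient_of (entry ms z e))" if "e < 2 * length ms" for e
  proof -
    have nat: "nat (2 * int e + 1) = Suc (2 * e)" "nat (2 * int e + 2) = Suc (2 * e + 1)" by linarith+
    have "input_code ms z ! Suc (2 * e) = fst (quotient_of (entry ms z e))"
      "input_code ms z ! Suc (2 * e + 1) = snd (quotient_of (entry ms z e))"
      using that nth_concat_pairs[of e "map (entry ms z) [0..<2 * length ms]" "\<lambda>r. fst (quotient_of r)" "\<lambda>r. snd (quotient_of r)"]
      by (simp_all add: input_code_eq rat_code_def[abs_def])
    then show "input_store ms z 0 (2 * int e + 1) = fst (quotient_of (entry ms z e))"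
      "input_store ms z 0 (2 * int e + 2) = snd (quotient_of (entry ms z e))"
      using that unfolding input_store_def length_input_code nat by auto
  qed
  moreover have "input_store ms z 0 0 = int (length ms)"
    by (simp add: input_store_def input_code_eq)
  ultimately show ?thesis by (simp add: presents_def)
qed

lemma bounded_input_store:
  assumes "distinct ms"
  shows "bounded_store (input_size ms z) (input_store ms z)"
proof -
  let ?N = "input_size ms z"
  have small: "\<bar>a\<bar> \<le> 2 ^ ?N" if "a \<in> set (rat_code (entry ms z e))" "e < 2 * length ms" for a e
  proof -
    have "rat_size (entry ms z e) \<le> (\<Sum>e<2 * length ms. rat_size (entry ms z e))"
      using that(2) by (intro member_le_sum) auto
    moreover have "int_size a \<le> rat_size (entry ms z e)"
      using that(1) by (auto simp: rat_code_def rat_size_def)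
    ultimately have "int_size a \<le> ?N" using input_size_eq[OF assms, of z] by linarith
    then have "(2::int) ^ int_size a \<le> 2 ^ ?N" by (intro power_increasing) auto
    then show ?thesis using int_less_power_int_size[of a] by linarith
  qed
  have "int (length ms) \<le> 2 ^ ?N"
    using of_nat_less_two_power[of ?N, where 'a = int] input_size_eq[OF assms, of z] by linarith
  then have "\<bar>a\<bar> \<le> 2 ^ ?N" if "a \<in> set (input_code ms z)" for a
    using that small by (auto simp: input_code_eq)
  then show ?thesis unfolding bounded_store_def input_store_def by auto
qed

text \<open>
  Therefore \<open>height\<close> is at most 2 to the power of the input size.
\<close>
lemma quotient_height_le:
  "(\<bar>fst (quotient_of r)\<bar> + 1) * snd (quotient_of r) \<le> 2 ^ rat_size r"
proof -
  have "\<bar>fst (quotient_of r)\<bar> + 1 \<le> 2 ^ int_size (fst (quotient_of r))"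
    using int_less_power_int_size[of "fst (quotient_of r)"] by simp
  moreover have "snd (quotient_of r) \<le> 2 ^ int_size (snd (quotient_of r))"
    using int_less_power_int_size[of "snd (quotient_of r)"] by simp
  ultimately show ?thesis
    using quotient_of_denom_pos'[of r] by (auto simp: rat_size_def power_add intro!: mult_mono)
qed

text \<open>
  With \<open>N\<close> the input size, \<open>n\<close> and \<open>height\<close> are at most \<open>2 ^ N\<close>, so the products of three such factors are
  covered by \<open>l = 3 * N + 3\<close>.
\<close>
lemma separation_input_of_point:
  assumes "distinct ms" "ms \<noteq> []"
  shows "separation_input (length ms) (\<lambda>e. fst (quotient_of (entry ms z e)))
    (\<lambda>e. snd (quotient_of (entry ms z e))) (3 * input_size ms z + 3)"
proof
  let ?n = "length ms" and ?N = "input_size ms z"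
  show "1 \<le> ?n" using assms(2) by (cases ms) auto
  show "1 \<le> 3 * ?N + 3" by simp
  show "0 < snd (quotient_of (entry ms z e))" for e by (rule quotient_of_denom_pos')
  have n: "int ?n + 1 \<le> 2 ^ ?N"
    using of_nat_less_two_power[of ?N, where 'a = int] input_size_eq[OF assms(1), of z] by linarith
  then have n': "length ms \<le> 2 ^ ?N"
    using less_exp[of ?N] input_size_eq[OF assms(1), of z] by linarith
  have "(\<Prod>i<2 * ?n. (\<bar>fst (quotient_of (entry ms z i))\<bar> + 1) * snd (quotient_of (entry ms z i)))
      \<le> (\<Prod>i<2 * ?n. 2 ^ rat_size (entry ms z i))"
    using quotient_of_denom_pos' quotient_height_le
    by (intro prod_mono conjI mult_nonneg_nonneg) (auto simp: less_imp_le)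
  also have "\<dots> = 2 ^ (\<Sum>i<2 * ?n. rat_size (entry ms z i))" by (simp add: power_sum)
  also have "\<dots> \<le> 2 ^ ?N" using input_size_eq[OF assms(1), of z] by (intro power_increasing) auto
  finally have P: "(\<Prod>i<2 * ?n. (\<bar>fst (quotient_of (entry ms z i))\<bar> + 1) * snd (quotient_of (entry ms z i))) \<le> 2 ^ ?N" .
  have "int (2 * ?n) * int ?n * (\<Prod>i<2 * ?n. (\<bar>fst (quotient_of (entry ms z i))\<bar> + 1) * snd (quotient_of (entry ms z i)))
      \<le> (2 * 2 ^ ?N) * 2 ^ ?N * 2 ^ ?N"
    using n n' P quotient_of_denom_pos' by (intro mult_mono prod_nonneg) (auto simp: less_imp_le)
  also have "\<dots> = 2 * 2 ^ (3 * ?N)" by (simp add: power_mult power3_eq_cube flip: power_mult_distrib)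
  finally have 1: "int (2 * ?n) * int ?n * (\<Prod>i<2 * ?n. (\<bar>fst (quotient_of (entry ms z i))\<bar> + 1) * snd (quotient_of (entry ms z i)))
      \<le> 2 * 2 ^ (3 * ?N)" .
  have "(2::int) ^ ?N \<le> 2 ^ (3 * ?N)" by (intro power_increasing) auto
  then have 2: "int (2 * ?n + 3) \<le> 3 * 2 ^ (3 * ?N)" using n \<open>1 \<le> ?n\<close> by linarith
  have "(2::int) ^ (3 * ?N + 3) = 8 * 2 ^ (3 * ?N)" by (simp add: power_add)
  then show "int (2 * ?n) * int ?n * (\<Prod>i<2 * ?n. (\<bar>fst (quotient_of (entry ms z i))\<bar> + 1) * snd (quotient_of (entry ms z i)))
      + int (2 * ?n + 3) \<le> 2 ^ (3 * ?N + 3)"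
    using 1 2 zero_le_power[of "2::int" "3 * ?N"] by linarith
qed

lemma entry_real_point: "entry ms (real_point z) e = of_rat (entry ms z e)"
  by (simp add: entry_def real_point_def Poly_Mapping.map.rep_eq when_def)

lemma keys_map_of_rat: "Poly_Mapping.keys (Poly_Mapping.map of_rat p) = Poly_Mapping.keys p"
  by (auto simp: in_keys_iff Poly_Mapping.map.rep_eq when_def)

text \<open>
  The factor \<open>3 * N + 3\<close> is the word length \<open>l\<close>; the remaining factor follows the two nested loops with
  \<open>2 * n + 2\<close> and \<open>2 * n\<close> iterations, with \<open>n\<close> replaced by its upper bound \<open>N\<close>.
\<close>
definition time_bound :: "nat poly" where
  "time_bound =
    (let a = [:straight_work (Store 1 (Const 0) (Const 1)) + (1 + aexp_work cut_test):];
         b = [:1 + aexp_work cut_test + straight_work init_cut_com + (1 + aexp_work entry_test) + straight_work verdict_com:];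
         d = [:1 + aexp_work entry_test + straight_work entry_com:]
     in [:3, 3:] * (a + [:2, 2:] * (b + [:0, 2:] * d)))"

lemma separation_work_le:
  assumes "separation_input n num den l" "n \<le> N"
  shows "(3 * N + 3) * separation_input.separation_work n \<le> poly time_bound N"
proof -
  interpret separation_input n num den l by fact
  define A where "A = straight_work (Store 1 (Const 0) (Const 1)) + (1 + aexp_work cut_test)"
  define B where "B = 1 + aexp_work cut_test + straight_work init_cut_com + (1 + aexp_work entry_test) + straight_work verdict_com"
  define E where "E = 1 + aexp_work entry_test + straight_work entry_com"
  have "separation_work = A + (2 * n + 2) * (B + 2 * n * E)"
    unfolding separation_work_def cut_work_def loop_work_def A_def B_def E_def
    by (simp add: algebra_simps del: straight_work.simps aexp_work.simps)
  also have "\<dots> \<le> A + (2 * N + 2) * (B + 2 * N * E)"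
    using assms(2) by (intro add_mono mult_mono) auto
  finally have "(3 * N + 3) * separation_work \<le> (3 * N + 3) * (A + (2 * N + 2) * (B + 2 * N * E))"
    by (rule mult_left_mono) simp
  also have "\<dots> = poly time_bound N"
    unfolding time_bound_def Let_def A_def[symmetric] B_def[symmetric] E_def[symmetric]
    by (simp only: poly_mult poly_add poly_pCons poly_0) (simp add: algebra_simps)
  finally show ?thesis .
qed

theorem mainTheorem3:
  shows "\<exists>(c :: com) (q :: nat poly).
    \<forall>(M :: nat set) (ms :: nat list) (x :: nat \<Rightarrow>\<^sub>0 rat) (y :: nat \<Rightarrow>\<^sub>0 rat).
      finite M \<and> M \<noteq> {} \<and> set ms = M \<and> distinct ms \<and>
      Poly_Mapping.keys x \<subseteq> M \<and> Poly_Mapping.keys y \<subseteq> {1..card M} \<longrightarrow>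
      (\<exists>t s. exec c (input_store ms (x, y)) t s \<and>
             t \<le> poly q (input_size ms (x, y)) \<and>
             correct_answer (linking_polyhedron M) ms (real_point (x, y)) s)"
proof (intro exI[of _ separation_com] exI[of _ time_bound] allI impI, elim conjE)
  fix M :: "nat set" and ms :: "nat list" and x y :: "nat \<Rightarrow>\<^sub>0 rat"
  assume M: "finite M" "M \<noteq> {}" "set ms = M" "distinct ms"
    and keys: "Poly_Mapping.keys x \<subseteq> M" "Poly_Mapping.keys y \<subseteq> {1..card M}"
  define n where "n = length ms"
  define N where "N = input_size ms (x, y)"
  define num where "num e = fst (quotient_of (entry ms (x, y) e))" for e
  define den where "den e = snd (quotient_of (entry ms (x, y) e))" for e
  have card: "card M = n" using M distinct_card n_def by blast
  have ms: "ms \<noteq> []" using M by auto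
  interpret separation_input n num den "3 * N + 3"
    using separation_input_of_point[OF M(4) ms, of "(x, y)"] by (simp add: n_def N_def num_def[abs_def] den_def[abs_def])
  have point: "entry ms (real_point (x, y)) e = of_int (num e) / of_int (den e)" for e
  proof -
    have "entry ms (x, y) e = of_int (num e) / of_int (den e)"
      using quotient_of_div[of "entry ms (x, y) e" "num e" "den e"] by (simp add: num_def den_def)
    then show ?thesis by (simp add: entry_real_point of_rat_divide)
  qed
  have "of_rat (cut_lhs c (2 * n)) = cut_value ms num den c (real_point (x, y))" for c
    unfolding cut_lhs_def cut_value_def n_def[symmetric]
    by (simp add: point of_rat_sum of_rat_mult of_rat_divide)
  then have violated: "cut_violated c \<longleftrightarrow> of_int (cut_rhs n c) < cut_value ms num den c (real_point (x, y))" for c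
    unfolding cut_violated_def by (metis of_rat_less of_rat_of_int_eq)
  have "bounded_store (3 * N + 3) (input_store ms (x, y))"
    using bounded_store_mono[OF bounded_input_store[OF M(4), of "(x, y)"], of "3 * N + 3"]
    by (simp add: N_def)
  moreover have "presents n num den (input_store ms (x, y))"
    using presents_input_store[of ms "(x, y)"] by (simp add: n_def num_def[abs_def] den_def[abs_def])
  ultimately obtain t s where exec: "exec separation_com (input_store ms (x, y)) t s"
    and t: "t \<le> (3 * N + 3) * separation_work"
    and s: "s 1 0 = 1 \<and> (\<forall>c<2 * n + 2. \<not> cut_violated c) \<or>
      s 1 0 = 0 \<and> (\<exists>c<2 * n + 2. outputs_cut c s \<and> cut_violated c)"
    using achieves_separation_com[of "input_store ms (x, y)"]
    unfolding achieves_def by (auto simp: input_store_def)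
  have "n \<le> N" using input_size_eq[OF M(4), of "(x, y)"] by (simp add: n_def N_def)
  then have "t \<le> poly time_bound N"
    using t separation_work_le[OF separation_input_axioms] by (meson order.trans)
  moreover have "correct_answer (linking_polyhedron M) ms (real_point (x, y)) s"
    using s
  proof (elim disjE conjE exE)
    assume v: "s 1 0 = 1" and "\<forall>c<2 * n + 2. \<not> cut_violated c"
    then have "cut_value ms num den c (real_point (x, y)) \<le> of_int (cut_rhs n c)" if "c < 2 * n + 2" for c
      using that violated by (simp add: not_less)
    moreover have "coord (fst (real_point (x, y))) (ms ! e) = of_int (num e) / of_int (den e)" if "e < n" for e
      using point[of e] that by (simp add: entry_def n_def)
    ultimately have "real_point (x, y) \<in> linking_polyhedron M"
      using keys card den_pos n_pos unfolding real_point_def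
      by (intro cuts_complete[OF M(4,3) n_def, where num = num and den = den]) (auto simp: keys_map_of_rat)
    then show ?thesis using v by (simp add: correct_answer_def asserts_membership_def)
  next
    fix c assume v: "s 1 0 = 0" and c: "c < 2 * n + 2" "outputs_cut c s" "cut_violated c"
    have "satisfies_output ms s z \<longleftrightarrow> cut_value ms num den c z \<le> of_int (cut_rhs n c)" for z
      using c(2) unfolding satisfies_output_iff cut_value_def n_def[symmetric] by (simp add: outputs_cut_def)
    then show ?thesis
      using v cut_valid[OF M(4,3)] c(1,3) violated
      by (simp add: correct_answer_def returns_inequality_def n_def not_le)
  qed
  ultimately show "\<exists>t s. exec separation_com (input_store ms (x, y)) t s \<and>
      t \<le> poly time_bound (input_size ms (x, y)) \<and>
      correct_answer (linking_polyhedron M) ms (real_point (x, y)) s"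
    using exec unfolding N_def by (intro exI conjI)
qed

end
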